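(* Let $p \colon E \to B$ be a locally trivial fibration with path-connected fibre $F$ and structure group $G$, where $E$ and $B$ are metrizable separable ANRs. If \begin{enumerate} \item $\tau \colon P \to B$ is a principal $G$-bundle such that the associated bundle $F \times_G P \to B$ is $p$, and \item $F \times F$ admits a $G$-invariant (not necessarily open) cover $\{U_i\}_{i=0}^{k}$ with $G$-equivariant sections $s_i \colon U_i \to F^I$ of the free path space fibration $\pi \colon F^{I} \to F \times F$ such that $\Delta F \subset U_0$, \end{enumerate} then $$\mathrm{TC}^{M}[p \colon E \to B] \leq k.$$ Moreover, if $\mathrm{TC}[p \colon E \to B] = k$, then $$\mathrm{TC}^{M}[p \colon E \to B] = \mathrm{TC}[p \colon E \to B] = \mathrm{TC}_g[p \colon E \to B] = k.$$
   Context: Convention: $G$ is a compact Lie group acting on Hausdorff spaces. Fibration means Hurewicz fibration, $I=[0,1]$. $G$ acts diagonally on $F\times F$ and by $(g\cdot\gamma)(t) = g\cdot\gamma(t)$ on $F^I$; $\pi(\gamma) = (\gamma(0),\gamma(1))$; a $G$-invariant cover is one by $G$-invariant subsets; $\Delta F$ is the diagonal of $F \times F$. $F\times_G P$ is the quotient of $F \times P$ by the $G$-action, with projection to $B$ induced by $\tau$. ANR means absolute neighborhood retract for metrizable spaces. Sections are continuous. For a fibration $p \colon E \to B$: $E \times_B E = \{(e_1,e_2)\in E\times E \mid p(e_1)=p(e_2)\}$ with diagonal $\Delta E = \{(e,e)\mid e\in E\}$; $E^I_B = \{\gamma \in E^I \mid p\circ\gamma \text{ is constant}\}$ (subspace of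 $E^I$ with compact-open topology); $\Pi \colon E^I_B \to E \times_B E$, $\Pi(\gamma) = (\gamma(0),\gamma(1))$, which is a fibration; $\mathrm{c}_e$ is the constant path at $e$. $\mathrm{TC}[p \colon E\to B]$ (parametrized topological complexity) is the sectional category of $\Pi$: the least nonnegative integer $n$ such that $E \times_B E$ has an open cover $\{V_0,\dots,V_n\}$ with a section of $\Pi$ over each $V_i$ ($\infty$ if none exists). $\mathrm{TC}_g[p \colon E\to B]$ is defined in the same way except that the covering sets are not required to be open. $\mathrm{TC}^{M}[p \colon E\to B]$ (monoidal parametrized topological complexity) is the least nonnegative integer $n$ such that $E \times_B E$ may be covered by open subsets $V_0,\dots,V_n$, each containing $\Delta E$ and admitting a section $\sigma_i \colon V_i \to E^I_B$ of $\Pi$ with $\sigma_i(e,e) = \mathrm{c}_e$ for all $e \in E$ ($\infty$ if none exists). *)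

theory Defs
  imports
    "HOL-Analysis.Analysis"
    "HOL-Algebra.Group_Action"
    "HOL-Library.Extended_Nat"
begin

section \<open>Lie groups\<close>

text \<open>
  The library type class of Euclidean spaces has no zero-dimensional instance, whereas finite
  groups are compact Lie groups. Manifolds are therefore modelled on \<^const>\<open>Euclidean_space\<close>
  \<open>n\<close>, whose points are the sequences vanishing from index \<open>n\<close> on. On an open subset, being of
  class \<open>C\<^sup>k\<close> means that all iterated partial derivatives of order at most \<open>k\<close> exist and are
  continuous.
\<close>

primrec Ck_on :: "nat \<Rightarrow> nat \<Rightarrow> (nat \<Rightarrow> real) set \<Rightarrow> ((nat \<Rightarrow> real) \<Rightarrow> real) \<Rightarrow> bool" where
  "Ck_on 0 n S f \<longleftrightarrow> continuous_map (subtopology (Euclidean_space n) S) euclideanreal f"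
| "Ck_on (Suc k) n S f \<longleftrightarrow>
     continuous_map (subtopology (Euclidean_space n) S) euclideanreal f \<and>
     (\<forall>i<n. \<exists>f'. (\<forall>x\<in>S. ((\<lambda>t. f (x(i := t))) has_real_derivative f' x) (at (x i))) \<and>
                 Ck_on k n S f')"

definition smooth_on :: "nat \<Rightarrow> nat \<Rightarrow> (nat \<Rightarrow> real) set \<Rightarrow> ((nat \<Rightarrow> real) \<Rightarrow> (nat \<Rightarrow> real)) \<Rightarrow> bool"
  where "smooth_on m n S f \<longleftrightarrow> (\<forall>j<n. \<forall>k. Ck_on k m S (\<lambda>x. f x j))"

type_synonym 'a chart = "'a set \<times> ('a \<Rightarrow> nat \<Rightarrow> real)"

definition smooth_between ::
  "nat \<Rightarrow> 'a topology \<Rightarrow> 'a chart set \<Rightarrow> nat \<Rightarrow> 'b topology \<Rightarrow> 'b chart set \<Rightarrow> ('a \<Rightarrow> 'b) \<Rightarrow> bool"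
  where "smooth_between m X A n Y A' f \<longleftrightarrow>
    continuous_map X Y f \<and>
    (\<forall>(U, \<phi>)\<in>A. \<forall>(V, \<psi>)\<in>A'.
       smooth_on m n (\<phi> ` {x \<in> U. f x \<in> V}) (\<lambda>y. \<psi> (f (inv_into U \<phi> y))))"

text \<open>The last conjunct, for the identity map, is smoothness of the transition functions.\<close>

definition smooth_manifold :: "nat \<Rightarrow> 'a topology \<Rightarrow> 'a chart set \<Rightarrow> bool" where
  "smooth_manifold n X A \<longleftrightarrow>
    Hausdorff_space X \<and> second_countable X \<and>
    (\<forall>(U, \<phi>)\<in>A. openin X U \<and> openin (Euclidean_space n) (\<phi> ` U) \<and>
       homeomorphic_map (subtopology X U) (subtopology (Euclidean_space n) (\<phi> ` U)) \<phi>) \<and>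
    \<Union> (fst ` A) = topspace X \<and>
    smooth_between n X A n X A (\<lambda>x. x)"

definition prod_atlas :: "nat \<Rightarrow> 'a chart set \<Rightarrow> 'b chart set \<Rightarrow> ('a \<times> 'b) chart set" where
  "prod_atlas m A A' =
    {(U \<times> V, \<lambda>(x, y) i. if i < m then \<phi> x i else \<psi> y (i - m)) | U \<phi> V \<psi>.
      (U, \<phi>) \<in> A \<and> (V, \<psi>) \<in> A'}"

definition lie_group ::
  "('g, 'z) monoid_scheme \<Rightarrow> 'g topology \<Rightarrow> nat \<Rightarrow> 'g chart set \<Rightarrow> bool" where
  "lie_group G T n A \<longleftrightarrow>
    group G \<and> topspace T = carrier G \<and> smooth_manifold n T A \<and>
    smooth_between (n + n) (prod_topology T T) (prod_atlas n A A) n T A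
      (\<lambda>(g, h). g \<otimes>\<^bsub>G\<^esub> h) \<and>
    smooth_between n T A n T A (\<lambda>g. inv\<^bsub>G\<^esub> g)"

section \<open>Group actions\<close>

definition continuous_action ::
  "('g, 'z) monoid_scheme \<Rightarrow> 'g topology \<Rightarrow> 'a topology \<Rightarrow> ('g \<Rightarrow> 'a \<Rightarrow> 'a) \<Rightarrow> bool" where
  "continuous_action G T X act \<longleftrightarrow>
    group_action G (topspace X) act \<and>
    continuous_map (prod_topology T X) X (\<lambda>(g, x). act g x)"

definition diag_act ::
  "('g \<Rightarrow> 'a \<Rightarrow> 'a) \<Rightarrow> ('g \<Rightarrow> 'b \<Rightarrow> 'b) \<Rightarrow> 'g \<Rightarrow> 'a \<times> 'b \<Rightarrow> 'a \<times> 'b" where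
  "diag_act act act' g = (\<lambda>(x, y). (act g x, act' g y))"

definition path_act :: "('g \<Rightarrow> 'a \<Rightarrow> 'a) \<Rightarrow> 'g \<Rightarrow> (real \<Rightarrow> 'a) \<Rightarrow> real \<Rightarrow> 'a" where
  "path_act act g \<gamma> = (\<lambda>t\<in>{0..1}. act g (\<gamma> t))"

definition invariant_set :: "('g, 'z) monoid_scheme \<Rightarrow> ('g \<Rightarrow> 'a \<Rightarrow> 'a) \<Rightarrow> 'a set \<Rightarrow> bool" where
  "invariant_set G act S \<longleftrightarrow> (\<forall>g\<in>carrier G. \<forall>x\<in>S. act g x \<in> S)"

definition equivariant_on ::
  "('g, 'z) monoid_scheme \<Rightarrow> ('g \<Rightarrow> 'a \<Rightarrow> 'a) \<Rightarrow> ('g \<Rightarrow> 'b \<Rightarrow> 'b) \<Rightarrow> 'a set \<Rightarrow> ('a \<Rightarrow> 'b) \<Rightarrow> bool" where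
  "equivariant_on G act act' S f \<longleftrightarrow> (\<forall>g\<in>carrier G. \<forall>x\<in>S. f (act g x) = act' g (f x))"

section \<open>Path spaces\<close>

abbreviation unit_interval :: "real topology" where
  "unit_interval \<equiv> top_of_set {0..1}"

text \<open>
  Paths are functions on \<^typ>\<open>real\<close> with the value \<^const>\<open>undefined\<close> outside \<open>[0,1]\<close>, so that
  equality of paths is equality on \<open>[0,1]\<close>.
\<close>

definition paths :: "'a topology \<Rightarrow> (real \<Rightarrow> 'a) set" where
  "paths X = {\<gamma> \<in> extensional {0..1}. continuous_map unit_interval X \<gamma>}"

text \<open>The compact-open topology.\<close>

definition path_space :: "'a topology \<Rightarrow> (real \<Rightarrow> 'a) topology" where
  "path_space X = topology_generated_by
     {{\<gamma> \<in> paths X. \<gamma> ` K \<subseteq> U} | K U. compactin unit_interval K \<and> openin X U}"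

lemma topspace_path_space [simp]: "topspace (path_space X) = paths X"
proof -
  have "paths X \<in> {{\<gamma> \<in> paths X. \<gamma> ` K \<subseteq> U} | K U. compactin unit_interval K \<and> openin X U}"
    by (rule CollectI, rule exI[of _ "{}"], rule exI[of _ "{}"]) auto
  then show ?thesis
    unfolding path_space_def topology_generated_by_topspace by blast
qed

definition const_path :: "'a \<Rightarrow> real \<Rightarrow> 'a" where
  "const_path e = (\<lambda>t\<in>{0..1}. e)"

definition endpoints :: "(real \<Rightarrow> 'a) \<Rightarrow> 'a \<times> 'a" where
  "endpoints \<gamma> = (\<gamma> 0, \<gamma> 1)"

section \<open>Fibrations and bundles\<close>

text \<open>
  The homotopy lifting property is required for all test spaces on the type
  \<^typ>\<open>'e \<times> (real \<Rightarrow> 'b)\<close>. This amounts to all test spaces, since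
  \<open>{(e, \<beta>) \<in> E \<times> B\<^sup>I. p e = \<beta> 0}\<close> lives on this type and every lifting problem is pulled back
  from the one posed by evaluation on that space.
\<close>

definition hurewicz_fibration :: "'e topology \<Rightarrow> 'b topology \<Rightarrow> ('e \<Rightarrow> 'b) \<Rightarrow> bool" where
  "hurewicz_fibration E B p \<longleftrightarrow>
    continuous_map E B p \<and>
    (\<forall>(Y :: ('e \<times> (real \<Rightarrow> 'b)) topology) f h.
       continuous_map Y E f \<and> continuous_map (prod_topology Y unit_interval) B h \<and>
       (\<forall>y\<in>topspace Y. p (f y) = h (y, 0)) \<longrightarrow>
       (\<exists>H. continuous_map (prod_topology Y unit_interval) E H \<and>
            (\<forall>y\<in>topspace Y. H (y, 0) = f y) \<and>
            (\<forall>y\<in>topspace Y. \<forall>t\<in>{0..1}. p (H (y, t)) = h (y, t))))"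

definition local_trivialization ::
  "'f topology \<Rightarrow> 'e topology \<Rightarrow> 'b topology \<Rightarrow> ('e \<Rightarrow> 'b) \<Rightarrow> 'b set \<Rightarrow> ('b \<times> 'f \<Rightarrow> 'e) \<Rightarrow> bool"
  where "local_trivialization F E B p U \<phi> \<longleftrightarrow>
    openin B U \<and>
    homeomorphic_map (prod_topology (subtopology B U) F)
      (subtopology E {e \<in> topspace E. p e \<in> U}) \<phi> \<and>
    (\<forall>b\<in>U. \<forall>x\<in>topspace F. p (\<phi> (b, x)) = b)"

text \<open>
  The cocycle condition on the transition functions \<open>\<theta>\<close> is not automatic, because the action on
  the fibre need not be effective.
\<close>

definition locally_trivial_with_group ::
  "('g, 'z) monoid_scheme \<Rightarrow> 'g topology \<Rightarrow> 'f topology \<Rightarrow> ('g \<Rightarrow> 'f \<Rightarrow> 'f) \<Rightarrow>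
   'e topology \<Rightarrow> 'b topology \<Rightarrow> ('e \<Rightarrow> 'b) \<Rightarrow> bool" where
  "locally_trivial_with_group G T F act E B p \<longleftrightarrow>
    continuous_map E B p \<and>
    (\<exists>(C :: ('b set \<times> ('b \<times> 'f \<Rightarrow> 'e)) set) \<theta>.
       (\<forall>(U, \<phi>)\<in>C. local_trivialization F E B p U \<phi>) \<and>
       \<Union> (fst ` C) = topspace B \<and>
       (\<forall>c\<in>C. \<forall>d\<in>C.
          continuous_map (subtopology B (fst c \<inter> fst d)) T (\<theta> c d) \<and>
          (\<forall>b\<in>fst c \<inter> fst d. \<forall>x\<in>topspace F. snd d (b, x) = snd c (b, act (\<theta> c d b) x))) \<and>
       (\<forall>c\<in>C. \<forall>d\<in>C. \<forall>a\<in>C. \<forall>b\<in>fst c \<inter> fst d \<inter> fst a.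
          \<theta> c d b \<otimes>\<^bsub>G\<^esub> \<theta> d a b = \<theta> c a b))"

text \<open>
  All actions are from the left; a right action on the total space of a principal bundle is
  turned into a left one by inversion.
\<close>

definition principal_bundle ::
  "('g, 'z) monoid_scheme \<Rightarrow> 'g topology \<Rightarrow> 'q topology \<Rightarrow> ('g \<Rightarrow> 'q \<Rightarrow> 'q) \<Rightarrow>
   'b topology \<Rightarrow> ('q \<Rightarrow> 'b) \<Rightarrow> bool" where
  "principal_bundle G T P act B \<tau> \<longleftrightarrow>
    continuous_action G T P act \<and> continuous_map P B \<tau> \<and>
    (\<forall>b\<in>topspace B. \<exists>U \<phi>. b \<in> U \<and> local_trivialization T P B \<tau> U \<phi> \<and>
       (\<forall>c\<in>U. \<forall>g\<in>carrier G. \<forall>h\<in>carrier G. \<phi> (c, g \<otimes>\<^bsub>G\<^esub> h) = act g (\<phi> (c, h))))"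

definition quotient_topology :: "'a topology \<Rightarrow> ('a \<Rightarrow> 'b) \<Rightarrow> 'b topology" where
  "quotient_topology X q =
    topology (\<lambda>U. U \<subseteq> q ` topspace X \<and> openin X {x \<in> topspace X. q x \<in> U})"

lemma openin_quotient_topology:
  "openin (quotient_topology X q) U \<longleftrightarrow>
   U \<subseteq> q ` topspace X \<and> openin X {x \<in> topspace X. q x \<in> U}"
proof -
  have "istopology (\<lambda>U. U \<subseteq> q ` topspace X \<and> openin X {x \<in> topspace X. q x \<in> U})"
    unfolding istopology_def
  proof (intro conjI allI impI)
    fix S U
    assume S: "S \<subseteq> q ` topspace X \<and> openin X {x \<in> topspace X. q x \<in> S}"
      and U: "U \<subseteq> q ` topspace X \<and> openin X {x \<in> topspace X. q x \<in> U}"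
    have "{x \<in> topspace X. q x \<in> S \<inter> U} =
          {x \<in> topspace X. q x \<in> S} \<inter> {x \<in> topspace X. q x \<in> U}"
      by blast
    then show "openin X {x \<in> topspace X. q x \<in> S \<inter> U}"
      using S U by (simp add: openin_Int)
  next
    fix \<K>
    assume K: "\<forall>K\<in>\<K>. K \<subseteq> q ` topspace X \<and> openin X {x \<in> topspace X. q x \<in> K}"
    have "{x \<in> topspace X. q x \<in> \<Union>\<K>} = (\<Union>K\<in>\<K>. {x \<in> topspace X. q x \<in> K})"
      by blast
    then show "openin X {x \<in> topspace X. q x \<in> \<Union>\<K>}"
      using K by auto
  qed auto
  then show ?thesis
    by (simp add: quotient_topology_def topology_inverse')
qed

lemma topspace_quotient_topology [simp]: "topspace (quotient_topology X q) = q ` topspace X"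
proof (rule antisym)
  show "topspace (quotient_topology X q) \<subseteq> q ` topspace X"
    using openin_quotient_topology[of X q "topspace (quotient_topology X q)"] by simp
  have "{x \<in> topspace X. q x \<in> q ` topspace X} = topspace X"
    by blast
  then have "openin (quotient_topology X q) (q ` topspace X)"
    by (simp add: openin_quotient_topology)
  then show "q ` topspace X \<subseteq> topspace (quotient_topology X q)"
    by (rule openin_subset)
qed

lemma quotient_map_quotient_topology: "quotient_map X (quotient_topology X q) q"
  by (auto simp: quotient_map_def openin_quotient_topology)

text \<open>The points of \<open>F \<times>\<^sub>G P\<close> are the orbits of the diagonal action.\<close>

definition associated_space ::
  "('g, 'z) monoid_scheme \<Rightarrow> 'f topology \<Rightarrow> ('g \<Rightarrow> 'f \<Rightarrow> 'f) \<Rightarrow>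
   'q topology \<Rightarrow> ('g \<Rightarrow> 'q \<Rightarrow> 'q) \<Rightarrow> ('f \<times> 'q) set topology" where
  "associated_space G F actF P actP =
    quotient_topology (prod_topology F P) (orbit G (diag_act actF actP))"

text \<open>
  The associated bundle, with projection \<open>[x, q] \<mapsto> \<tau> q\<close>, is identified with \<open>p\<close> by a
  homeomorphism over \<open>B\<close>.
\<close>

definition is_associated_bundle ::
  "('g, 'z) monoid_scheme \<Rightarrow> 'f topology \<Rightarrow> ('g \<Rightarrow> 'f \<Rightarrow> 'f) \<Rightarrow>
   'q topology \<Rightarrow> ('g \<Rightarrow> 'q \<Rightarrow> 'q) \<Rightarrow> ('q \<Rightarrow> 'b) \<Rightarrow> 'e topology \<Rightarrow> ('e \<Rightarrow> 'b) \<Rightarrow> bool" where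
  "is_associated_bundle G F actF P actP \<tau> E p \<longleftrightarrow>
    (\<exists>\<Phi>. homeomorphic_map (associated_space G F actF P actP) E \<Phi> \<and>
       (\<forall>x\<in>topspace F. \<forall>q\<in>topspace P.
          p (\<Phi> (orbit G (diag_act actF actP) (x, q))) = \<tau> q))"

section \<open>Absolute neighbourhood retracts\<close>

text \<open>
  The library predicate \<^const>\<open>ANR\<close> concerns subsets of Euclidean spaces only. The metrizable
  spaces \<open>Y\<close> are taken on the type \<^typ>\<open>'a \<Rightarrow> real\<close>; this is no restriction, because by the
  theorem of Kuratowski and Wojdyslawski \<open>X\<close> is a closed subset of a convex subset \<open>Z\<close> of a
  normed space of real functions on \<open>X\<close>, and by Dugundji's theorem a neighbourhood retract of
  \<open>Z\<close> is one of every metrizable space containing it as a closed subset.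
\<close>

definition metrizable_ANR :: "'a topology \<Rightarrow> bool" where
  "metrizable_ANR X \<longleftrightarrow>
    metrizable_space X \<and>
    (\<forall>(Y :: ('a \<Rightarrow> real) topology) S.
       metrizable_space Y \<and> closedin Y S \<and> X homeomorphic_space subtopology Y S \<longrightarrow>
       (\<exists>U. openin Y U \<and> S retract_of_space subtopology Y U))"

section \<open>Parametrized topological complexity\<close>

definition section_over ::
  "'a topology \<Rightarrow> 'b topology \<Rightarrow> ('a \<Rightarrow> 'b) \<Rightarrow> 'b set \<Rightarrow> ('b \<Rightarrow> 'a) \<Rightarrow> bool" where
  "section_over X Y f V s \<longleftrightarrow>
    V \<subseteq> topspace Y \<and> continuous_map (subtopology Y V) X s \<and> (\<forall>v\<in>V. f (s v) = v)"

definition fib_prod :: "'e topology \<Rightarrow> ('e \<Rightarrow> 'b) \<Rightarrow> ('e \<times> 'e) topology" where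
  "fib_prod E p = subtopology (prod_topology E E) {(e1, e2). p e1 = p e2}"

definition fib_path_space :: "'e topology \<Rightarrow> ('e \<Rightarrow> 'b) \<Rightarrow> (real \<Rightarrow> 'e) topology" where
  "fib_path_space E p = subtopology (path_space E) {\<gamma>. \<exists>b. \<forall>t\<in>{0..1}. p (\<gamma> t) = b}"

text \<open>All invariants take values in \<^typ>\<open>enat\<close>, where the infimum of the empty set is \<open>\<infinity>\<close>.\<close>

definition secat :: "'a topology \<Rightarrow> 'b topology \<Rightarrow> ('a \<Rightarrow> 'b) \<Rightarrow> enat" where
  "secat X Y f = Inf {enat n | n. \<exists>V. (\<Union>i\<le>n. V i) = topspace Y \<and>
     (\<forall>i\<le>n. openin Y (V i) \<and> (\<exists>s. section_over X Y f (V i) s))}"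

definition secat_g :: "'a topology \<Rightarrow> 'b topology \<Rightarrow> ('a \<Rightarrow> 'b) \<Rightarrow> enat" where
  "secat_g X Y f = Inf {enat n | n. \<exists>V. (\<Union>i\<le>n. V i) = topspace Y \<and>
     (\<forall>i\<le>n. \<exists>s. section_over X Y f (V i) s)}"

definition TC :: "'e topology \<Rightarrow> ('e \<Rightarrow> 'b) \<Rightarrow> enat" where
  "TC E p = secat (fib_path_space E p) (fib_prod E p) endpoints"

definition TC_g :: "'e topology \<Rightarrow> ('e \<Rightarrow> 'b) \<Rightarrow> enat" where
  "TC_g E p = secat_g (fib_path_space E p) (fib_prod E p) endpoints"

definition TC_M :: "'e topology \<Rightarrow> ('e \<Rightarrow> 'b) \<Rightarrow> enat" where
  "TC_M E p = Inf {enat n | n. \<exists>V. (\<Union>i\<le>n. V i) = topspace (fib_prod E p) \<and>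
     (\<forall>i\<le>n. openin (fib_prod E p) (V i) \<and> Id_on (topspace E) \<subseteq> V i \<and>
        (\<exists>s. section_over (fib_path_space E p) (fib_prod E p) endpoints (V i) s \<and>
             (\<forall>e\<in>topspace E. s (e, e) = const_path e)))}"

end

(*
  By equivariance the motions s_i of the fibre, transported by the local trivializations, glue to
  fibrewise motions of E over subsets of E x_B E, which need not be open. As E and B are ANRs, such a
  motion is approximated by one defined on an open set: average nearby paths in a convex set
  containing E as a neighbourhood retract, and push the resulting paths back into the fibres by
  lifting short homotopies in B. The same correction applied to short segments gives a motion near
  the diagonal that is constant on the diagonal. It serves to normalize the motion on the set
  containing the diagonal and to modify the other sets near the diagonal, at no cost in their number.
*)

theory Submission
  imports Defs "HOL-Probability.Discrete_Topology"
begin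

section \<open>The compact-open topology\<close>

text \<open>A Hurewicz fibration may lift a constant path to a moving one. Careless lifting would
  thus destroy exactly what the correction has to preserve: the end points of a motion, and its
  constancy on the diagonal. For this reason every lift is slowed down by a real function vanishing
  where the path to be lifted is constant. The vector space in which nearby paths are averaged is
  the space of bounded functions on the ANR: the Kuratowski embedding has closed image in its own
  convex hull, and an open subset of that hull retracts onto the image. Separability of the total
  space makes its fibre product hereditarily Lindelof, so the averages can be formed with a
  countable partition of unity. The bound stays at \<open>k\<close> because a single set contains
  the whole diagonal. It covers all that the other sets lose when they are cut back near the
  diagonal. Motions are handled as maps on \<open>V \<times> [0,1]\<close> rather than as maps into
  a path space. A condition on a whole path is then open in the parameter by the tube lemma.\<close>

lemma openin_forall_compactin:
  assumes K: "compactin Y K" and S: "openin (prod_topology X Y) S"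
  shows "openin X {x \<in> topspace X. \<forall>y\<in>K. (x, y) \<in> S}"
proof (subst openin_subopen, intro ballI)
  fix x assume x: "x \<in> {x \<in> topspace X. \<forall>y\<in>K. (x, y) \<in> S}"
  then obtain U V where "openin X U" "x \<in> U" "K \<subseteq> V" "U \<times> V \<subseteq> S"
    using tube_lemma_right[OF S K, of x] by blast
  moreover from this have "U \<subseteq> {x \<in> topspace X. \<forall>y\<in>K. (x, y) \<in> S}"
    using openin_subset by blast
  ultimately show "\<exists>T. openin X T \<and> x \<in> T \<and> T \<subseteq> {x \<in> topspace X. \<forall>y\<in>K. (x, y) \<in> S}"
    by blast
qed

lemma openin_forall_unit_interval:
  assumes "openin (prod_topology X unit_interval) S"
  shows "openin X {x \<in> topspace X. \<forall>t\<in>{0..1}. (x, t) \<in> S}"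
  using openin_forall_compactin[OF _ assms, of "{0..1}"] by (simp add: compactin_subtopology)

lemma continuous_map_slice:
  assumes "continuous_map (prod_topology Y X) Z h" "y \<in> topspace Y"
  shows "continuous_map X Z (\<lambda>t. h (y, t))"
  using continuous_map_compose[of X "prod_topology Y X" "\<lambda>t. (y, t)" Z h] assms
  by (simp add: continuous_map_pairwise o_def)

text \<open>One half of the exponential law: the preimage of a subbasic open set asks for an open
  condition along a compact set of times, so the tube lemma applies.\<close>

lemma continuous_map_into_path_space:
  assumes h: "continuous_map (prod_topology Y unit_interval) X h"
  shows "continuous_map Y (path_space X) (\<lambda>y. \<lambda>t\<in>{0..1}. h (y, t))"
proof -
  have sl: "(\<lambda>t\<in>{0..1}. h (y, t)) \<in> paths X" if "y \<in> topspace Y" for y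
    using continuous_map_slice[OF h that]
    by (auto simp: paths_def elim: continuous_map_eq)
  show ?thesis
    unfolding path_space_def
  proof (rule continuous_on_generated_topo)
    fix W assume "W \<in> {{\<gamma> \<in> paths X. \<gamma> ` K \<subseteq> U} |K U. compactin unit_interval K \<and> openin X U}"
    then obtain K U where W: "W = {\<gamma> \<in> paths X. \<gamma> ` K \<subseteq> U}"
      and K: "compactin unit_interval K" and U: "openin X U" by blast
    have K01: "K \<subseteq> {0..1}" using compactin_subset_topspace[OF K] by simp
    have "(\<lambda>y. \<lambda>t\<in>{0..1}. h (y, t)) -` W \<inter> topspace Y =
      {y \<in> topspace Y. \<forall>t\<in>K. (y, t) \<in> {z \<in> topspace (prod_topology Y unit_interval). h z \<in> U}}"
      using sl K01 by (auto simp: W image_subset_iff subset_iff)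
    then show "openin Y ((\<lambda>y. \<lambda>t\<in>{0..1}. h (y, t)) -` W \<inter> topspace Y)"
      using openin_forall_compactin[OF K openin_continuous_map_preimage[OF h U]] by simp
  next
    show "(\<lambda>y. \<lambda>t\<in>{0..1}. h (y, t)) ` topspace Y
      \<subseteq> \<Union> {{\<gamma> \<in> paths X. \<gamma> ` K \<subseteq> U} |K U. compactin unit_interval K \<and> openin X U}"
      using sl topspace_path_space[of X]
      unfolding path_space_def topology_generated_by_topspace by blast
  qed
qed

text \<open>The other half of the exponential law rests on local compactness of the interval: a
  small closed ball \<open>K\<close> around the time \<open>t\<close> is a compact neighbourhood on
  which the path stays in \<open>U\<close>, and the paths mapping \<open>K\<close> into
  \<open>U\<close> form a subbasic open set.\<close>

lemma continuous_map_path_eval: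
  assumes f: "continuous_map Y (path_space X) f"
  shows "continuous_map (prod_topology Y unit_interval) X (\<lambda>(y, t). f y t)"
proof -
  have fp: "f y \<in> paths X" if "y \<in> topspace Y" for y
    using continuous_map_image_subset_topspace[OF f] that by auto
  have "\<exists>W. openin (prod_topology Y unit_interval) W \<and> (y, t) \<in> W \<and> (\<forall>(u, s)\<in>W. f u s \<in> U)"
    if y: "y \<in> topspace Y" and t: "t \<in> {0..1}" and U: "openin X U" and yU: "f y t \<in> U" for y t U
  proof -
    have c: "continuous_map unit_interval X (f y)" using fp[OF y] by (simp add: paths_def)
    have "openin unit_interval {s \<in> {0..1}. f y s \<in> U}"
      using openin_continuous_map_preimage[OF c U] by simp
    then obtain e where e: "e > 0" "cball t e \<inter> {0..1} \<subseteq> {s \<in> {0..1}. f y s \<in> U}"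
      using t yU unfolding openin_contains_cball by blast
    define K where "K = cball t e \<inter> {0..1}"
    have K: "compactin unit_interval K"
      by (auto simp: K_def compactin_subtopology)
    have "openin (path_space X) {\<gamma> \<in> paths X. \<gamma> ` K \<subseteq> U}"
      unfolding path_space_def by (rule topology_generated_by_Basis) (use K U in blast)
    from openin_continuous_map_preimage[OF f this]
    have o: "openin Y {u \<in> topspace Y. f u \<in> {\<gamma> \<in> paths X. \<gamma> ` K \<subseteq> U}}" .
    have "openin unit_interval (ball t e \<inter> {0..1})"
      by (metis Int_commute open_ball openin_open_Int)
    then have "openin (prod_topology Y unit_interval)
      ({u \<in> topspace Y. f u \<in> {\<gamma> \<in> paths X. \<gamma> ` K \<subseteq> U}} \<times> (ball t e \<inter> {0..1}))"
      using o by (auto simp: openin_prod_Times_iff)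
    moreover have "f y ` K \<subseteq> U" using e by (auto simp: K_def)
    ultimately show ?thesis
      using y t e fp[OF y] by (intro exI[of _ "_ \<times> _"] conjI) (auto simp: K_def)
  qed note loc = this
  have im: "f y t \<in> topspace X" if "y \<in> topspace Y" "t \<in> {0..1}" for y t
    using fp[OF that(1)] that(2) by (auto simp: paths_def continuous_map_def)
  show ?thesis
    unfolding continuous_map_def
  proof (intro conjI allI impI)
    fix U assume U: "openin X U"
    show "openin (prod_topology Y unit_interval)
      {x \<in> topspace (prod_topology Y unit_interval). (\<lambda>(y, t). f y t) x \<in> U}"
    proof (subst openin_subopen, intro ballI)
      fix x assume x: "x \<in> {x \<in> topspace (prod_topology Y unit_interval). (\<lambda>(y, t). f y t) x \<in> U}"
      obtain y t where xy: "x = (y, t)" by force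
      obtain W where W: "openin (prod_topology Y unit_interval) W" "(y, t) \<in> W"
        "\<forall>(u, s)\<in>W. f u s \<in> U"
        using loc[of y t U] x U unfolding xy by auto
      show "\<exists>T. openin (prod_topology Y unit_interval) T \<and> x \<in> T \<and>
        T \<subseteq> {x \<in> topspace (prod_topology Y unit_interval). (\<lambda>(y, t). f y t) x \<in> U}"
        using W openin_subset[OF W(1)] by (intro exI[of _ W]) (auto simp: xy)
    qed
  qed (use im in auto)
qed

section \<open>Regular lifting\<close>

lemma continuous_map_unit_interval_iff:
  "continuous_map X unit_interval f \<longleftrightarrow>
    continuous_map X euclideanreal f \<and> (\<forall>x\<in>topspace X. f x \<in> {0..1})"
  by (auto simp: continuous_map_in_subtopology)

text \<open>The quotient \<open>t / j y\<close> has no limit where \<open>j\<close> vanishes, but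
  none is needed: the whole path over such a \<open>y\<close> is constant, so by the tube lemma all
  nearby paths stay in a given neighbourhood of its value, whatever the time. At the point itself
  division by zero yields time 0.\<close>

lemma continuous_map_truncated_homotopy:
  assumes D: "continuous_map (prod_topology Y unit_interval) B D"
    and j: "continuous_map Y unit_interval j"
    and const: "\<And>y t. y \<in> topspace Y \<Longrightarrow> j y = 0 \<Longrightarrow> t \<in> {0..1} \<Longrightarrow> D (y, t) = D (y, 0)"
  shows "continuous_map (prod_topology Y unit_interval) B (\<lambda>(y, t). D (y, min 1 (t / j y)))"
proof -
  have j01: "j y \<in> {0..1}" if "y \<in> topspace Y" for y
    using j that by (auto simp: continuous_map_unit_interval_iff)
  have m01: "min 1 (t / j y) \<in> {0..1}" if "y \<in> topspace Y" "t \<in> {0..1}" for y t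
    using j01[OF that(1)] that(2) by auto
  define P where "P = {y \<in> topspace Y. j y \<noteq> 0}"
  have jr: "continuous_map Y euclideanreal j" using j by (simp add: continuous_map_unit_interval_iff)
  have "P = {y \<in> topspace Y. j y \<in> - {0}}" by (auto simp: P_def)
  moreover have "openin Y {y \<in> topspace Y. j y \<in> - {0}}"
    by (rule openin_continuous_map_preimage[OF jr]) auto
  ultimately have oP: "openin Y P" by simp
  let ?D = "\<lambda>(y, t). D (y, min 1 (t / j y))"
  have cP: "continuous_map (subtopology (prod_topology Y unit_interval) (P \<times> {0..1})) B ?D"
  proof -
    let ?S = "subtopology (prod_topology Y unit_interval) (P \<times> {0..1})"
    have 1: "continuous_map ?S Y fst"
      by (simp add: continuous_map_fst continuous_map_from_subtopology)
    have "continuous_map ?S unit_interval snd"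
      by (simp add: continuous_map_snd continuous_map_from_subtopology)
    then have 2: "continuous_map ?S euclideanreal snd"
      by (simp add: continuous_map_in_subtopology)
    have 3: "continuous_map ?S euclideanreal (\<lambda>x. j (fst x))"
      using continuous_map_compose[OF 1 jr] by (simp add: o_def)
    have "continuous_map ?S euclideanreal (\<lambda>x. snd x / j (fst x))"
      by (rule continuous_map_real_divide[OF 2 3]) (auto simp: P_def)
    then have "continuous_map ?S euclideanreal (\<lambda>x. min 1 (snd x / j (fst x)))"
      by (intro continuous_map_real_min) auto
    then have 4: "continuous_map ?S unit_interval (\<lambda>x. min 1 (snd x / j (fst x)))"
      using m01 by (auto simp: continuous_map_unit_interval_iff)
    have "continuous_map ?S (prod_topology Y unit_interval) (\<lambda>x. (fst x, min 1 (snd x / j (fst x))))"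
      using 1 4 by (simp add: continuous_map_pairwise o_def)
    from continuous_map_compose[OF this D] show ?thesis
      by (simp add: o_def case_prod_unfold)
  qed
  show ?thesis
    unfolding continuous_map_def
  proof (intro conjI allI impI)
    fix U assume U: "openin B U"
    define S where "S = {x \<in> topspace (prod_topology Y unit_interval). ?D x \<in> U}"
    have oS: "openin (prod_topology Y unit_interval) (S \<inter> P \<times> {0..1})"
    proof -
      have "openin (subtopology (prod_topology Y unit_interval) (P \<times> {0..1}))
         {x \<in> topspace (subtopology (prod_topology Y unit_interval) (P \<times> {0..1})). ?D x \<in> U}"
        by (rule openin_continuous_map_preimage[OF cP U])
      moreover have "openin (prod_topology Y unit_interval) (P \<times> {0..1})"
        using oP by (auto simp: openin_prod_Times_iff)
      ultimately have "openin (prod_topology Y unit_interval)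
         {x \<in> topspace (subtopology (prod_topology Y unit_interval) (P \<times> {0..1})). ?D x \<in> U}"
        by (rule openin_trans_full)
      also have "{x \<in> topspace (subtopology (prod_topology Y unit_interval) (P \<times> {0..1})). ?D x \<in> U}
        = S \<inter> P \<times> {0..1}" by (auto simp: S_def)
      finally show ?thesis .
    qed
    have "openin (prod_topology Y unit_interval) S"
    proof (subst openin_subopen, intro ballI)
      fix x assume x: "x \<in> S"
      obtain y t where xy: "x = (y, t)" by force
      have yt: "y \<in> topspace Y" "t \<in> {0..1}" using x by (auto simp: S_def xy)
      show "\<exists>T. openin (prod_topology Y unit_interval) T \<and> x \<in> T \<and> T \<subseteq> S"
      proof (cases "j y = 0")
        case False
        then show ?thesis using oS x yt by (intro exI[of _ "S \<inter> P \<times> {0..1}"]) (auto simp: xy P_def)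
      next
        case True
        then have "D (y, 0) \<in> U" using x by (simp add: S_def xy)
        define Q where "Q = {u \<in> topspace Y. \<forall>s\<in>{0..1}. (u, s) \<in>
            {z \<in> topspace (prod_topology Y unit_interval). D z \<in> U}}"
        have "openin Y Q"
          unfolding Q_def
          by (rule openin_forall_unit_interval[OF openin_continuous_map_preimage[OF D U]])
        moreover have "y \<in> Q"
        proof -
          have "D (y, s) \<in> U" if "s \<in> {0..1}" for s
            using const[OF yt(1) True that] \<open>D (y, 0) \<in> U\<close> by simp
          then show ?thesis using yt by (simp add: Q_def)
        qed
        moreover have "Q \<times> {0..1} \<subseteq> S"
        proof clarify
          fix u and s :: real assume u: "u \<in> Q" and s: "s \<in> {0..1}"
          then have "u \<in> topspace Y" by (simp add: Q_def)
          then show "(u, s) \<in> S" using u m01[of u s] s by (simp add: Q_def S_def)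
        qed
        ultimately show ?thesis
          using yt by (intro exI[of _ "Q \<times> {0..1}"]) (auto simp: xy openin_prod_Times_iff)
      qed
    qed
    then show "openin (prod_topology Y unit_interval)
        {x \<in> topspace (prod_topology Y unit_interval). ?D x \<in> U}" by (simp add: S_def)
  next
    have "D z \<in> topspace B" if "z \<in> topspace (prod_topology Y unit_interval)" for z
      using continuous_map_image_subset_topspace[OF D] that by blast
    then show "?D \<in> topspace (prod_topology Y unit_interval) \<rightarrow> topspace B"
      using m01 by (simp add: Pi_iff)
  qed
qed

text \<open>The lift over the path \<open>D y\<close>, stretched by the factor \<open>1 / j y\<close>, is run at speed \<open>j y\<close>; so it
  does not move where \<open>j\<close> vanishes.\<close>

lemma hurewicz_fibration_regular_lift:
  fixes Y :: "'y topology" and E :: "'e topology" and B :: "'b topology"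
  assumes p: "hurewicz_fibration E B p"
    and f: "continuous_map Y E f"
    and D: "continuous_map (prod_topology Y unit_interval) B D"
    and pf: "\<And>y. y \<in> topspace Y \<Longrightarrow> p (f y) = D (y, 0)"
    and j: "continuous_map Y unit_interval j"
    and const: "\<And>y t. y \<in> topspace Y \<Longrightarrow> j y = 0 \<Longrightarrow> t \<in> {0..1} \<Longrightarrow> D (y, t) = D (y, 0)"
  obtains H where "continuous_map (prod_topology Y unit_interval) E H"
    "\<And>y. y \<in> topspace Y \<Longrightarrow> H (y, 0) = f y"
    "\<And>y t. y \<in> topspace Y \<Longrightarrow> t \<in> {0..1} \<Longrightarrow> p (H (y, t)) = D (y, t)"
    "\<And>y t. y \<in> topspace Y \<Longrightarrow> j y = 0 \<Longrightarrow> t \<in> {0..1} \<Longrightarrow> H (y, t) = f y"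
proof -
  \<comment> \<open>The universal lifting problem. It lives on the type for which the lifting
    property is stated, while \<open>Y\<close> has an arbitrary type; its solution is pulled back
    along \<open>g\<close>.\<close>
  define \<Omega> where "\<Omega> = subtopology (prod_topology E (path_space B)) {(e, \<beta>). p e = \<beta> 0}"
  have fst\<Omega>: "continuous_map \<Omega> E fst" and snd\<Omega>: "continuous_map \<Omega> (path_space B) snd"
    unfolding \<Omega>_def
    by (auto simp: continuous_map_fst continuous_map_snd continuous_map_from_subtopology)
  have "\<forall>y\<in>topspace \<Omega>. p (fst y) = (\<lambda>(y, t). snd y t) (y, 0)"
    by (auto simp: \<Omega>_def)
  then obtain H where H: "continuous_map (prod_topology \<Omega> unit_interval) E H"
    and H0: "\<And>y. y \<in> topspace \<Omega> \<Longrightarrow> H (y, 0) = fst y"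
    and "\<forall>y\<in>topspace \<Omega>. \<forall>t\<in>{0..1}. p (H (y, t)) = (\<lambda>(y, t). snd y t) (y, t)"
    using p[unfolded hurewicz_fibration_def, THEN conjunct2, rule_format,
        of \<Omega> fst "\<lambda>(y, t). snd y t"] fst\<Omega> continuous_map_path_eval[OF snd\<Omega>] by blast
  then have pH: "\<And>y t. y \<in> topspace \<Omega> \<Longrightarrow> t \<in> {0..1} \<Longrightarrow> p (H (y, t)) = snd y t"
    by simp
  define D' where "D' = (\<lambda>(y, t). D (y, min 1 (t / j y)))"
  have D': "continuous_map (prod_topology Y unit_interval) B D'"
    unfolding D'_def by (rule continuous_map_truncated_homotopy[OF D j const])
  define g where "g y = (f y, \<lambda>t\<in>{0..1}. D' (y, t))" for y
  have "continuous_map Y (prod_topology E (path_space B)) g"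
    using f continuous_map_into_path_space[OF D'] by (simp add: g_def continuous_map_pairwise o_def)
  then have g: "continuous_map Y \<Omega> g"
    using pf by (auto simp: \<Omega>_def continuous_map_in_subtopology g_def D'_def)
  then have gt: "g y \<in> topspace \<Omega>" if "y \<in> topspace Y" for y
    using that by (auto simp: continuous_map_def)
  have jr: "continuous_map Y euclideanreal j" and j01: "\<And>y. y \<in> topspace Y \<Longrightarrow> j y \<in> {0..1}"
    using j by (simp_all add: continuous_map_unit_interval_iff)
  define H' where "H' = (\<lambda>(y, t). H (g y, j y * t))"
  have jt: "j y * t \<in> {0..1}" if "y \<in> topspace Y" "t \<in> {0..1}" for y t
    using j01[OF that(1)] that(2) by (auto intro: mult_le_one)
  show ?thesis
  proof
    let ?YI = "prod_topology Y unit_interval"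
    have s: "continuous_map ?YI euclideanreal snd"
      using continuous_map_snd[of Y unit_interval] by (simp add: continuous_map_in_subtopology)
    have "continuous_map ?YI euclideanreal (\<lambda>x. j (fst x) * snd x)"
      using continuous_map_compose[OF continuous_map_fst jr]
      by (intro continuous_map_real_mult s) (simp add: o_def)
    then have "continuous_map ?YI unit_interval (\<lambda>x. j (fst x) * snd x)"
      using jt by (auto simp: continuous_map_unit_interval_iff)
    moreover have "continuous_map ?YI \<Omega> (\<lambda>x. g (fst x))"
      using continuous_map_compose[OF continuous_map_fst g] by (simp add: o_def)
    ultimately have "continuous_map ?YI (prod_topology \<Omega> unit_interval) (\<lambda>x. (g (fst x), j (fst x) * snd x))"
      by (simp add: continuous_map_pairwise o_def)
    from continuous_map_compose[OF this H]
    show "continuous_map ?YI E H'" by (simp add: H'_def o_def case_prod_unfold)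
  next
    fix y assume y: "y \<in> topspace Y"
    show "H' (y, 0) = f y"
      using H0[OF gt[OF y]] by (simp add: H'_def g_def)
  next
    fix y and t :: real assume y: "y \<in> topspace Y" and t: "t \<in> {0..1}"
    have "p (H' (y, t)) = D' (y, j y * t)"
      using pH[OF gt[OF y] jt[OF y t]] jt[OF y t] by (simp add: H'_def g_def)
    also have "\<dots> = D (y, t)"
    proof (cases "j y = 0")
      case True then show ?thesis using const[OF y True t] by (simp add: D'_def)
    next
      case False then show ?thesis using t by (simp add: D'_def)
    qed
    finally show "p (H' (y, t)) = D (y, t)" .
  next
    fix y and t :: real assume y: "y \<in> topspace Y" and "j y = 0"
    then show "H' (y, t) = f y"
      using H0[OF gt[OF y]] by (simp add: H'_def g_def)
  qed
qed

section \<open>Absolute neighbourhood retracts\<close>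

lemma metrizable_space_bounded_metric:
  assumes "metrizable_space X"
  obtains d where "Metric_space (topspace X) d" "Metric_space.mtopology (topspace X) d = X"
    "\<And>x y. d x y \<le> (1::real)"
proof -
  obtain M d where "Metric_space M d" and X: "X = Metric_space.mtopology M d"
    using assms by (auto simp: metrizable_space_def)
  then interpret Metric_space M d by simp
  have M: "M = topspace X" by (simp add: X)
  show thesis
  proof (rule that[of "capped_dist 1"])
    show "Metric_space (topspace X) (capped_dist 1)"
      using capped_dist by (simp flip: M)
    show "Metric_space.mtopology (topspace X) (capped_dist 1) = X"
      using mtopology_capped_metric by (simp flip: M add: X)
  qed (simp add: capped_dist_def)
qed

text \<open>With the discrete topology on the source, the type of bounded continuous functions provides the
  normed space of all bounded functions.\<close>

definition kuratowski :: "'a set \<Rightarrow> ('a \<Rightarrow> 'a \<Rightarrow> real) \<Rightarrow> 'a \<Rightarrow> 'a discrete \<Rightarrow>\<^sub>C real" where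
  "kuratowski M d x = Bcontfun (\<lambda>y. if of_discrete y \<in> M then d x (of_discrete y) else 0)"

text \<open>Carries subsets of the normed space injectively to the type
  \<open>'a \<Rightarrow> real\<close>, where the test spaces in the definition of an ANR
  live.\<close>

definition discrete_eval :: "('a discrete \<Rightarrow>\<^sub>C real) \<Rightarrow> 'a \<Rightarrow> real" where
  "discrete_eval f x = apply_bcontfun f (discrete x)"

lemma inj_discrete_eval: "inj discrete_eval"
proof (rule injI, rule bcontfun_eqI)
  fix f g :: "'a discrete \<Rightarrow>\<^sub>C real" and x
  assume "discrete_eval f = discrete_eval g"
  then have "discrete_eval f (of_discrete x) = discrete_eval g (of_discrete x)" by simp
  then show "apply_bcontfun f x = apply_bcontfun g x"
    by (simp add: discrete_eval_def of_discrete_inverse)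
qed

context Metric_space
begin

lemma discrete_eval_kuratowski:
  assumes "\<And>x y. d x y \<le> 1"
  shows "discrete_eval (kuratowski M d x) y = (if y \<in> M then d x y else 0)"
proof -
  let ?f = "\<lambda>y. if of_discrete y \<in> M then d x (of_discrete y) else 0"
  have "continuous_on UNIV ?f"
    by (simp add: continuous_on_open_invariant open_discrete)
  moreover have "bounded (range ?f)"
    by (rule boundedI[of _ 1]) (use assms in auto)
  ultimately have "?f \<in> bcontfun" by (simp add: bcontfun_def)
  then show ?thesis
    by (simp add: discrete_eval_def kuratowski_def Bcontfun_inverse discrete_inverse)
qed

text \<open>The triangle inequality bounds the supremum distance from above, and evaluation at
  \<open>y\<close> attains the bound.\<close>

lemma dist_kuratowski:
  assumes b: "\<And>x y. d x y \<le> 1" and x: "x \<in> M" and y: "y \<in> M"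
  shows "dist (kuratowski M d x) (kuratowski M d y) = d x y"
proof (rule antisym)
  have e: "apply_bcontfun (kuratowski M d u) z = (if of_discrete z \<in> M then d u (of_discrete z) else 0)" for u z
    using discrete_eval_kuratowski[OF b, of u "of_discrete z"]
    by (simp add: discrete_eval_def of_discrete_inverse)
  show "dist (kuratowski M d x) (kuratowski M d y) \<le> d x y"
  proof (rule dist_bound)
    fix z
    have "\<bar>d x (of_discrete z) - d y (of_discrete z)\<bar> \<le> d x y" if "of_discrete z \<in> M"
      using triangle[OF x y that] triangle[OF y x that] commute[of x y] by linarith
    then show "dist (apply_bcontfun (kuratowski M d x) z) (apply_bcontfun (kuratowski M d y) z) \<le> d x y"
      by (simp add: e dist_real_def)
  qed
  show "d x y \<le> dist (kuratowski M d x) (kuratowski M d y)"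
    using dist_bounded[of "kuratowski M d x" "discrete y" "kuratowski M d y"] y x
    by (simp add: e discrete_inverse dist_real_def mdist_zero)
qed

text \<open>Wojdyslawski: if \<open>\<Sum>\<^sub>v u\<^sub>v d v\<close> is a limit of functions \<open>d y\<close>, then evaluation at \<open>y\<close> shows
  that \<open>u\<^sub>v d v y\<close> tends to \<open>0\<close>, so \<open>y\<close> tends to \<open>v\<close> for every \<open>v\<close> of positive weight.\<close>

lemma closedin_kuratowski_convex_hull:
  assumes b: "\<And>x y. d x y \<le> 1"
  shows "closedin (top_of_set (convex hull (kuratowski M d ` M))) (kuratowski M d ` M)"
proof -
  let ?\<kappa> = "kuratowski M d"
  have "g \<in> ?\<kappa> ` M" if g: "g \<in> convex hull (?\<kappa> ` M)" and cl: "g \<in> closure (?\<kappa> ` M)" for g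
  proof -
    obtain S u where S: "finite S" "S \<subseteq> ?\<kappa> ` M" "\<forall>x\<in>S. 0 \<le> u x" "sum u S = 1"
      and gS: "(\<Sum>v\<in>S. u v *\<^sub>R v) = g"
      using g unfolding convex_hull_explicit by blast
    have "\<exists>v\<in>S. u v > 0"
    proof (rule ccontr)
      assume "\<not> (\<exists>v\<in>S. 0 < u v)"
      then have "\<forall>v\<in>S. u v = 0" using S(3) by force
      then show False using S(4) by simp
    qed
    then obtain a where a: "a \<in> M" "?\<kappa> a \<in> S" "u (?\<kappa> a) > 0" using S(2) by blast
    define c where "c = u (?\<kappa> a)"
    have c: "c > 0" using a by (simp add: c_def)
    have geq: "apply_bcontfun g z = (\<Sum>v\<in>S. u v * apply_bcontfun v z)" for z
    proof -
      have "apply_bcontfun (\<Sum>v\<in>T. u v *\<^sub>R v) z = (\<Sum>v\<in>T. u v * apply_bcontfun v z)" if "finite T" for T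
        using that by (induction T rule: finite_induct) auto
      then show ?thesis using S(1) gS by blast
    qed
    have "dist g (?\<kappa> a) < e" if e: "e > 0" for e
    proof -
      \<comment> \<open>Two errors add up: \<open>e'\<close> from \<open>g\<close> to the embedded
        \<open>y\<close>, and \<open>e' / c\<close> from \<open>y\<close> to \<open>a\<close>. The
        choice makes their sum equal to \<open>e\<close>.\<close>
      define e' where "e' = e / (1 + 1 / c)"
      have e': "e' > 0" using e c by (simp add: e'_def add_pos_pos)
      obtain y where y: "y \<in> M" "dist (?\<kappa> y) g < e'"
        using cl e' unfolding closure_approachable by blast
      have k: "discrete_eval (?\<kappa> x) y = d x y" for x
        using discrete_eval_kuratowski[OF b] y(1) by simp
      have "dist (discrete_eval (?\<kappa> y) y) (discrete_eval g y) < e'"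
        using dist_fun_lt_imp_dist_val_lt[OF y(2)] by (simp add: discrete_eval_def)
      then have "discrete_eval g y < e'"
        using y(1) by (simp add: k mdist_zero dist_real_def)
      moreover have "c * d a y \<le> discrete_eval g y"
      proof -
        have "c * d a y = u (?\<kappa> a) * apply_bcontfun (?\<kappa> a) (discrete y)"
          using k[of a] by (simp add: c_def discrete_eval_def)
        also have "\<dots> \<le> (\<Sum>v\<in>S. u v * apply_bcontfun v (discrete y))"
        proof (rule member_le_sum[OF a(2) _ S(1)])
          fix v assume v: "v \<in> S - {?\<kappa> a}"
          then obtain x where "v = ?\<kappa> x" using S(2) by blast
          then have "apply_bcontfun v (discrete y) \<ge> 0" using k[of x] by (simp add: discrete_eval_def)
          then show "0 \<le> u v * apply_bcontfun v (discrete y)" using S(3) v by simp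
        qed
        finally show ?thesis by (simp add: geq discrete_eval_def)
      qed
      ultimately have "d a y < e' / c" using c by (simp add: pos_less_divide_eq mult.commute)
      then have "dist g (?\<kappa> a) < e' + e' / c"
        using y dist_triangle[of g "?\<kappa> a" "?\<kappa> y"] dist_kuratowski[OF b y(1) a(1)]
          commute[of a y] by (simp add: dist_commute)
      also have "e' + e' / c = e"
      proof -
        have "e' + e' / c = e' * (1 + 1 / c)" by (simp add: algebra_simps)
        also have "\<dots> = e" using add_pos_pos[of 1 "1 / c"] c by (simp add: e'_def)
        finally show ?thesis .
      qed
      finally show ?thesis .
    qed
    from this[of "dist g (?\<kappa> a)"] have "g = ?\<kappa> a"
      by (cases "g = ?\<kappa> a") auto
    then show ?thesis using a(1) by blast
  qed
  then have "convex hull (?\<kappa> ` M) \<inter> closure (?\<kappa> ` M) \<subseteq> ?\<kappa> ` M" by auto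
  moreover have "?\<kappa> ` M \<subseteq> convex hull (?\<kappa> ` M) \<inter> closure (?\<kappa> ` M)"
    by (simp add: hull_subset closure_subset)
  ultimately have "convex hull (?\<kappa> ` M) \<inter> closure (?\<kappa> ` M) = ?\<kappa> ` M" by (rule antisym)
  moreover have "closedin (top_of_set (convex hull (?\<kappa> ` M)))
      (convex hull (?\<kappa> ` M) \<inter> closure (?\<kappa> ` M))"
    by (rule closedin_closed_Int) simp
  ultimately show ?thesis by simp
qed

lemma homeomorphic_map_kuratowski:
  assumes b: "\<And>x y. d x y \<le> 1"
  shows "homeomorphic_map mtopology (top_of_set (kuratowski M d ` M)) (kuratowski M d)"
proof -
  let ?\<kappa> = "kuratowski M d"
  note dk = dist_kuratowski[OF b]
  have inj: "inj_on ?\<kappa> M"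
    by (rule inj_onI) (metis dk dist_self zero)
  have "continuous_map mtopology Met_TC.mtopology ?\<kappa>"
    by (subst metric_continuous_map[OF Met_TC.Metric_space_axioms]) (auto simp: dk)
  then have cont: "continuous_map mtopology (top_of_set (?\<kappa> ` M)) ?\<kappa>"
    by (auto simp: continuous_map_in_subtopology)
  moreover have "open_map mtopology (top_of_set (?\<kappa> ` M)) ?\<kappa>"
    unfolding open_map_def
  proof (intro allI impI)
    fix U assume "openin mtopology U"
    then have U: "U \<subseteq> M" "\<And>x. x \<in> U \<Longrightarrow> \<exists>r>0. mball x r \<subseteq> U" by (auto simp: openin_mtopology)
    show "openin (top_of_set (?\<kappa> ` M)) (?\<kappa> ` U)"
      unfolding openin_contains_ball
    proof (intro conjI ballI)
      fix z assume "z \<in> ?\<kappa> ` U"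
      then obtain x where x: "x \<in> U" "z = ?\<kappa> x" by blast
      obtain r where r: "r > 0" "mball x r \<subseteq> U" using U(2)[OF x(1)] by blast
      have "ball z r \<inter> ?\<kappa> ` M \<subseteq> ?\<kappa> ` U"
      proof clarify
        fix y assume y: "?\<kappa> y \<in> ball z r" "y \<in> M"
        then have "d x y < r" using dk[of x y] x U(1) by auto
        moreover have "x \<in> M" using x(1) U(1) by blast
        ultimately have "y \<in> mball x r" using y(2) by (simp add: in_mball)
        then have "y \<in> U" using r(2) by blast
        then show "?\<kappa> y \<in> ?\<kappa> ` U" by blast
      qed
      then show "\<exists>e>0. ball z e \<inter> ?\<kappa> ` M \<subseteq> ?\<kappa> ` U" using r(1) by blast
    qed (use U(1) in blast)
  qed
  ultimately show ?thesis
    by (intro bijective_open_imp_homeomorphic_map) (auto simp: inj)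
qed

end

text \<open>This gives a place to form convex combinations of points of \<open>X\<close>: as long as
  they stay in \<open>W\<close>, the map \<open>r\<close> brings them back to \<open>X\<close>. The
  embedded space is closed in its convex hull \<open>Z\<close>, so the ANR property, applied to a
  homeomorphic copy of \<open>Z\<close>, retracts a neighbourhood onto it.\<close>

lemma metrizable_ANR_convex_chart:
  fixes X :: "'a topology"
  assumes X: "metrizable_ANR X"
  obtains Z W and \<kappa> :: "'a \<Rightarrow> 'a discrete \<Rightarrow>\<^sub>C real" and r
  where "convex Z" "openin (top_of_set Z) W" "continuous_map X (top_of_set W) \<kappa>"
    "continuous_map (top_of_set W) X r" "\<And>x. x \<in> topspace X \<Longrightarrow> r (\<kappa> x) = x"
proof -
  define M where "M = topspace X"
  obtain d where "Metric_space M d" and XM: "Metric_space.mtopology M d = X"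
    and b: "\<And>x y. d x y \<le> (1::real)"
    using metrizable_space_bounded_metric[of X] X by (auto simp: metrizable_ANR_def M_def)
  then interpret Metric_space M d by simp
  define \<kappa> where "\<kappa> = kuratowski M d"
  define Z where "Z = convex hull (\<kappa> ` M)"
  have \<kappa>Z: "\<kappa> ` M \<subseteq> Z" by (simp add: Z_def hull_subset)
  have h\<kappa>: "homeomorphic_map X (top_of_set (\<kappa> ` M)) \<kappa>"
    using homeomorphic_map_kuratowski[OF b] by (simp add: XM \<kappa>_def)
  define Y where "Y = quotient_topology (top_of_set Z) discrete_eval"
  have inj: "inj_on discrete_eval T" for T :: "('a discrete \<Rightarrow>\<^sub>C real) set"
    using inj_discrete_eval inj_on_subset by blast
  have h: "homeomorphic_map (top_of_set Z) Y discrete_eval"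
    using quotient_map_quotient_topology[of "top_of_set Z" discrete_eval] inj
    unfolding Y_def homeomorphic_map_def by simp
  define S where "S = discrete_eval ` \<kappa> ` M"
  have hS: "homeomorphic_map (top_of_set (\<kappa> ` M)) (subtopology Y S) discrete_eval"
  proof -
    have "topspace Y \<inter> S = S" using \<kappa>Z by (auto simp: Y_def S_def)
    then have "homeomorphic_map (subtopology (top_of_set Z) (\<kappa> ` M)) (subtopology Y S) discrete_eval"
      using \<kappa>Z by (intro homeomorphic_map_subtopologies[OF h]) (simp add: S_def Int_absorb1)
    then show ?thesis using \<kappa>Z by (simp add: subtopology_subtopology Int_absorb1)
  qed
  have "metrizable_space (top_of_set Z)"
    by (simp add: metrizable_space_subtopology metrizable_space_euclidean)
  then have "metrizable_space Y"
    using h homeomorphic_map_imp_homeomorphic_space homeomorphic_metrizable_space by blast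
  moreover have "closedin Y S"
    using closedin_kuratowski_convex_hull[OF b] homeomorphic_map_closedness[OF h, of "\<kappa> ` M"] \<kappa>Z
    unfolding S_def \<kappa>_def Z_def by auto
  moreover have "X homeomorphic_space subtopology Y S"
    by (rule homeomorphic_space_trans[OF homeomorphic_map_imp_homeomorphic_space[OF h\<kappa>]
          homeomorphic_map_imp_homeomorphic_space[OF hS]])
  ultimately obtain U where U: "openin Y U" and ret: "S retract_of_space subtopology Y U"
    using X[unfolded metrizable_ANR_def, THEN conjunct2, rule_format, of Y S] by blast
  have SU: "S \<subseteq> U" using retract_of_space_imp_subset[OF ret] by simp
  obtain \<rho> where "continuous_map (subtopology Y U) (subtopology (subtopology Y U) S) \<rho>"
    and \<rho>S: "\<And>x. x \<in> S \<Longrightarrow> \<rho> x = x"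
    using ret unfolding retract_of_space_def by blast
  moreover have "subtopology (subtopology Y U) S = subtopology Y S"
    using SU by (simp add: subtopology_subtopology Int_absorb1)
  ultimately have \<rho>: "continuous_map (subtopology Y U) (subtopology Y S) \<rho>" by simp
  define W where "W = {z \<in> Z. discrete_eval z \<in> U}"
  have oW: "openin (top_of_set Z) W"
    using openin_continuous_map_preimage[OF homeomorphic_imp_continuous_map[OF h] U]
    by (simp add: W_def)
  obtain k where k: "homeomorphic_maps (top_of_set (\<kappa> ` M)) (subtopology Y S) discrete_eval k"
    using hS homeomorphic_map_maps by blast
  obtain l where l: "homeomorphic_maps X (top_of_set (\<kappa> ` M)) \<kappa> l"
    using h\<kappa> homeomorphic_map_maps by blast
  have "continuous_map (top_of_set W) (subtopology Y U) discrete_eval"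
  proof -
    have "continuous_map (top_of_set W) Y discrete_eval"
      by (rule continuous_map_from_subtopology_mono[OF homeomorphic_imp_continuous_map[OF h]])
        (simp add: W_def)
    then show ?thesis by (auto simp: continuous_map_in_subtopology W_def)
  qed
  \<comment> \<open>The map \<open>r\<close> goes to the copy of \<open>Z\<close>, applies the
    retraction \<open>\<rho>\<close>, and returns by the inverses \<open>k\<close> and
    \<open>l\<close> of the two embeddings.\<close>
  then have "continuous_map (top_of_set W) X (l \<circ> (k \<circ> (\<rho> \<circ> discrete_eval)))"
    using \<rho> k l unfolding homeomorphic_maps_def by (meson continuous_map_compose)
  moreover have "(l \<circ> (k \<circ> (\<rho> \<circ> discrete_eval))) (\<kappa> x) = x" if "x \<in> topspace X" for x
  proof -
    have "\<kappa> x \<in> \<kappa> ` M" using that by (simp add: M_def)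
    then have "k (discrete_eval (\<kappa> x)) = \<kappa> x" "\<rho> (discrete_eval (\<kappa> x)) = discrete_eval (\<kappa> x)"
      using k \<rho>S by (auto simp: homeomorphic_maps_def S_def)
    then show ?thesis using l that by (simp add: homeomorphic_maps_def)
  qed
  moreover have "continuous_map X (top_of_set W) \<kappa>"
  proof -
    have "\<kappa> ` M \<subseteq> W" using SU \<kappa>Z by (auto simp: W_def S_def)
    then show ?thesis
      using homeomorphic_imp_continuous_map[OF h\<kappa>]
      by (auto simp: continuous_map_in_subtopology M_def)
  qed
  ultimately show ?thesis
    using that[of Z W \<kappa> "l \<circ> (k \<circ> (\<rho> \<circ> discrete_eval))"] oW by (simp add: Z_def)
qed

section \<open>Short paths in absolute neighbourhood retracts\<close>

lemma continuous_map_scaleR: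
  fixes g :: "'a \<Rightarrow> 'b::real_normed_vector"
  assumes "continuous_map X euclideanreal f" "continuous_map X euclidean g"
  shows "continuous_map X euclidean (\<lambda>x. f x *\<^sub>R g x)"
  using assms by (simp add: continuous_map_atin tendsto_scaleR)

lemma continuous_map_top_of_setD:
  "continuous_map X (top_of_set S) f \<Longrightarrow> continuous_map X euclidean f"
  by (simp add: continuous_map_in_subtopology)

lemma prod_topology_subtopology_fst:
  "prod_topology (subtopology X S) Y = subtopology (prod_topology X Y) (S \<times> UNIV)"
  by (simp add: subtopology_Times)

text \<open>The path from \<open>x\<close> to \<open>y\<close> is the segment between their images
  in the convex set, pushed into \<open>X\<close> by \<open>r\<close>. The pairs whose whole segment
  stays in \<open>W\<close> form an open set by the tube lemma; it contains the diagonal, where the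
  segment is a point.\<close>

lemma metrizable_ANR_locally_equiconnected:
  fixes X :: "'a topology"
  assumes X: "metrizable_ANR X"
  obtains N c where "openin (prod_topology X X) N" "Id_on (topspace X) \<subseteq> N"
    "continuous_map (prod_topology (subtopology (prod_topology X X) N) unit_interval) X c"
    "\<And>x y. (x, y) \<in> N \<Longrightarrow> c ((x, y), 0) = x"
    "\<And>x y. (x, y) \<in> N \<Longrightarrow> c ((x, y), 1) = y"
    "\<And>x t. x \<in> topspace X \<Longrightarrow> c ((x, x), t) = x"
proof -
  obtain Z W and \<kappa> :: "'a \<Rightarrow> 'a discrete \<Rightarrow>\<^sub>C real" and r
    where Z: "convex Z" and oW: "openin (top_of_set Z) W"
      and \<kappa>: "continuous_map X (top_of_set W) \<kappa>" and r: "continuous_map (top_of_set W) X r"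
      and r\<kappa>: "\<And>x. x \<in> topspace X \<Longrightarrow> r (\<kappa> x) = x"
    by (rule metrizable_ANR_convex_chart[OF X]) (rule that)
  have \<kappa>W: "\<kappa> x \<in> W" if "x \<in> topspace X" for x
    using \<kappa> that by (auto simp: continuous_map_in_subtopology)
  have WZ: "W \<subseteq> Z" using openin_subset[OF oW] by simp
  define l where "l = (\<lambda>(xy, t). (1 - t) *\<^sub>R \<kappa> (fst xy) + t *\<^sub>R \<kappa> (snd xy))"
  let ?P = "prod_topology (prod_topology X X) unit_interval"
  have \<kappa>e: "continuous_map X euclidean \<kappa>" using \<kappa> by (rule continuous_map_top_of_setD)
  have f: "continuous_map ?P euclidean (\<lambda>z. \<kappa> (fst (fst z)))"
    and g: "continuous_map ?P euclidean (\<lambda>z. \<kappa> (snd (fst z)))"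
    and t: "continuous_map ?P euclideanreal snd"
    using continuous_map_compose[OF continuous_map_compose[OF continuous_map_fst continuous_map_fst] \<kappa>e]
      continuous_map_compose[OF continuous_map_compose[OF continuous_map_fst continuous_map_snd] \<kappa>e]
      continuous_map_top_of_setD[OF continuous_map_snd]
    by (simp_all add: o_def)
  have "continuous_map ?P euclidean l"
    unfolding l_def case_prod_unfold
    by (intro continuous_map_add continuous_map_scaleR continuous_map_diff f g t) auto
  moreover have "l z \<in> Z" if "z \<in> topspace ?P" for z
    using that \<kappa>W WZ Z by (auto simp: l_def intro!: convexD_alt)
  ultimately have l: "continuous_map ?P (top_of_set Z) l"
    by (auto simp: continuous_map_in_subtopology)
  define N where "N = {xy \<in> topspace (prod_topology X X).
    \<forall>t\<in>{0..1}. (xy, t) \<in> {z \<in> topspace ?P. l z \<in> W}}"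
  have lN: "l (xy, t) \<in> W" if "xy \<in> N" "t \<in> {0..1}" for xy t
    using that by (simp add: N_def)
  show thesis
  proof
    show "openin (prod_topology X X) N"
      unfolding N_def
      by (rule openin_forall_unit_interval[OF openin_continuous_map_preimage[OF l oW]])
    have "l ((x, x), t) = \<kappa> x" for x t by (simp add: l_def flip: scaleR_left_distrib)
    then show "Id_on (topspace X) \<subseteq> N" and "\<And>x t. x \<in> topspace X \<Longrightarrow> (r \<circ> l) ((x, x), t) = x"
      using \<kappa>W r\<kappa> by (auto simp: N_def)
    have "prod_topology (subtopology (prod_topology X X) N) unit_interval =
      subtopology ?P (N \<times> UNIV)"
      by (rule prod_topology_subtopology_fst)
    moreover have "continuous_map (subtopology ?P (N \<times> UNIV)) (top_of_set W) l"
      using continuous_map_from_subtopology[OF continuous_map_top_of_setD[OF l]] lN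
      by (auto simp: continuous_map_in_subtopology)
    ultimately show "continuous_map (prod_topology (subtopology (prod_topology X X) N) unit_interval) X (r \<circ> l)"
      using continuous_map_compose[OF _ r] by simp
    show "(r \<circ> l) ((x, y), 0) = x" "(r \<circ> l) ((x, y), 1) = y" if "(x, y) \<in> N" for x y
      using that r\<kappa> by (auto simp: N_def l_def)
  qed
qed

section \<open>Extension of homotopies to open sets\<close>

lemma metrizable_separable_imp_second_countable:
  assumes "metrizable_space X" "separable_space X"
  shows "second_countable X"
proof -
  obtain M d where "Metric_space M d" and X: "X = Metric_space.mtopology M d"
    using assms by (auto simp: metrizable_space_def)
  then interpret Metric_space M d by simp
  obtain C where C: "countable C" "C \<subseteq> M" "mtopology closure_of C = M"
    using assms(2) by (auto simp: separable_space_def X)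
  show ?thesis
    unfolding second_countable_def
  proof (intro exI conjI allI impI ballI)
    let ?B = "(\<lambda>(c, n). mball c (inverse (real (Suc n)))) ` (C \<times> UNIV)"
    show "countable ?B" using C(1) by auto
    show "openin X V" if "V \<in> ?B" for V using that by (auto simp: X)
    fix U x assume Ux: "openin X U \<and> x \<in> U"
    then have "openin mtopology U" "x \<in> U" by (auto simp: X)
    then obtain r where r: "r > 0" "mball x r \<subseteq> U" and x: "x \<in> M"
      unfolding openin_mtopology by blast
    obtain n where n: "inverse (real (Suc n)) < r / 2"
      using reals_Archimedean[of "r / 2"] r(1) by auto
    have "x \<in> mtopology closure_of C" using C(3) x by simp
    then have "\<forall>r>0. \<exists>y\<in>C. y \<in> mball x r" by (simp add: metric_closure_of)
    then obtain c where c: "c \<in> C" "c \<in> mball x (inverse (real (Suc n)))"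
      by (meson inverse_positive_iff_positive of_nat_0_less_iff zero_less_Suc)
    have "mball c (inverse (real (Suc n))) \<subseteq> mball x r"
    proof
      fix y assume "y \<in> mball c (inverse (real (Suc n)))"
      then show "y \<in> mball x r"
        using c(2) triangle[of x c y] n by (auto simp: in_mball)
    qed
    moreover have "x \<in> mball c (inverse (real (Suc n)))"
      using c(2) by (auto simp: in_mball commute)
    moreover have "mball c (inverse (real (Suc n))) \<in> ?B" using c(1) by blast
    ultimately show "\<exists>V\<in>?B. x \<in> V \<and> V \<subseteq> U"
      using r(2) by (intro bexI[of _ "mball c (inverse (real (Suc n)))"]) auto
  qed
qed

lemma second_countable_prod_topology:
  assumes "second_countable X" "second_countable Y"
  shows "second_countable (prod_topology X Y)"
proof -
  obtain \<A> where A: "countable \<A>" "\<And>V. V \<in> \<A> \<Longrightarrow> openin X V"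
    "\<And>U x. openin X U \<and> x \<in> U \<longrightarrow> (\<exists>V\<in>\<A>. x \<in> V \<and> V \<subseteq> U)"
    using assms(1) by (auto simp: second_countable_def)
  obtain \<B> where B: "countable \<B>" "\<And>V. V \<in> \<B> \<Longrightarrow> openin Y V"
    "\<And>U x. openin Y U \<and> x \<in> U \<longrightarrow> (\<exists>V\<in>\<B>. x \<in> V \<and> V \<subseteq> U)"
    using assms(2) by (auto simp: second_countable_def)
  show ?thesis
    unfolding second_countable_def
  proof (intro exI conjI allI impI ballI)
    let ?C = "(\<lambda>(V, W). V \<times> W) ` (\<A> \<times> \<B>)"
    show "countable ?C" using A(1) B(1) by auto
    show "openin (prod_topology X Y) V" if "V \<in> ?C" for V
      using that A(2) B(2) by (auto simp: openin_prod_Times_iff)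
    fix U z assume U: "openin (prod_topology X Y) U \<and> z \<in> U"
    obtain x y where z: "z = (x, y)" by force
    obtain V W where VW: "openin X V" "openin Y W" "x \<in> V" "y \<in> W" "V \<times> W \<subseteq> U"
      using U unfolding openin_prod_topology_alt z by blast
    obtain V' where V': "V' \<in> \<A>" "x \<in> V'" "V' \<subseteq> V" using A(3)[of V x] VW(1,3) by blast
    obtain W' where W': "W' \<in> \<B>" "y \<in> W'" "W' \<subseteq> W" using B(3)[of W y] VW(2,4) by blast
    have "V' \<times> W' \<in> ?C" using V'(1) W'(1) by blast
    moreover have "z \<in> V' \<times> W'" "V' \<times> W' \<subseteq> U" using V' W' VW(5) by (auto simp: z)
    ultimately show "\<exists>V\<in>?C. z \<in> V \<and> V \<subseteq> U" by (intro bexI[of _ "V' \<times> W'"]) auto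
  qed
qed

section \<open>Local continuity and countable partitions of unity\<close>

lemma continuous_map_locally:
  assumes "\<And>x. x \<in> topspace X \<Longrightarrow>
    \<exists>U. openin X U \<and> x \<in> U \<and> continuous_map (subtopology X U) Y f"
  shows "continuous_map X Y f"
proof -
  obtain U where U: "\<And>x. x \<in> topspace X \<Longrightarrow>
      openin X (U x) \<and> x \<in> U x \<and> continuous_map (subtopology X (U x)) Y f"
    using assms by metis
  show ?thesis
    by (rule pasting_lemma[where I = "topspace X" and T = U and f = "\<lambda>_. f"]) (use U in auto)
qed

text \<open>Local finiteness is forced by subtracting from \<open>f n\<close> the
  \<open>n\<close>-fold maximum of its predecessors: once some \<open>f m\<close> is positive near
  \<open>x\<close>, this multiple eventually exceeds 1. Positivity survives, since nothing is
  subtracted at the first index where \<open>f\<close> is positive. Division by the sum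
  normalizes.\<close>

lemma countable_partition_of_unity:
  fixes f :: "nat \<Rightarrow> 'a \<Rightarrow> real"
  assumes cont: "\<And>n. continuous_map X euclideanreal (f n)"
    and f01: "\<And>n x. x \<in> topspace X \<Longrightarrow> f n x \<in> {0..1}"
    and pos: "\<And>x. x \<in> topspace X \<Longrightarrow> \<exists>n. f n x > 0"
  obtains w where "\<And>n. continuous_map X euclideanreal (w n)"
    "\<And>n x. x \<in> topspace X \<Longrightarrow> w n x \<ge> 0"
    "\<And>n x. x \<in> topspace X \<Longrightarrow> w n x \<noteq> 0 \<Longrightarrow> f n x > 0"
    "\<And>x. x \<in> topspace X \<Longrightarrow> \<exists>U N. openin X U \<and> x \<in> U \<and>
       (\<forall>u\<in>U. (\<forall>n\<ge>N. w n u = 0) \<and> (\<Sum>n<N. w n u) = (1::real))"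
proof -
  \<comment> \<open>The maximum runs over the indices below \<open>n\<close> only, and is 0 for
    \<open>n = 0\<close>.\<close>
  define mx where "mx n x = rec_nat 0 (\<lambda>i y. max y (f i x)) n" for n x
  have mx0: "mx 0 x = 0" and mxS: "mx (Suc n) x = max (mx n x) (f n x)" for n x
    by (simp_all add: mx_def)
  have mxc: "continuous_map X euclideanreal (mx n)" for n
  proof (induction n)
    case 0 show ?case by (simp add: mx0[abs_def])
  next
    case (Suc n) then show ?case
      unfolding mxS[abs_def] using cont by (intro continuous_map_real_max) auto
  qed
  have mx_ge: "f m x \<le> mx n x" if "m < n" for m n x
    using that by (induction n) (auto simp: mxS less_Suc_eq)
  have mx_zero: "mx n x = 0" if "x \<in> topspace X" "\<And>m. m < n \<Longrightarrow> \<not> f m x > 0" for n x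
    using that(2)
  proof (induction n)
    case (Suc n)
    then show ?case using f01[OF that(1), of n] by (force simp: mxS)
  qed (simp add: mx0)
  define g where "g n x = max 0 (f n x - real n * mx n x)" for n x
  have gc: "continuous_map X euclideanreal (g n)" for n
    unfolding g_def using cont mxc
    by (intro continuous_map_real_max continuous_map_diff continuous_map_real_mult) auto
  have g0: "g n x \<ge> 0" for n x by (simp add: g_def)
  have mxn: "mx n x \<ge> 0" for n x by (induction n) (auto simp: mx0 mxS)
  have gf: "f n x > 0" if "g n x \<noteq> 0" for n x
  proof -
    have "real n * mx n x \<ge> 0" using mxn by simp
    then show ?thesis using that unfolding g_def by linarith
  qed
  have first: "\<exists>m. f m x > 0 \<and> g m x > 0" if x: "x \<in> topspace X" for x
  proof -
    define m where "m = (LEAST m. f m x > 0)"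
    have "f m x > 0" using pos[OF x] unfolding m_def by (rule LeastI_ex)
    moreover have "\<not> f i x > 0" if "i < m" for i
      using that not_less_Least unfolding m_def by blast
    ultimately show ?thesis using mx_zero[OF x, of m] by (intro exI[of _ m]) (auto simp: g_def)
  qed
  have loc: "\<exists>U N. openin X U \<and> x \<in> U \<and> (\<forall>u\<in>U. \<forall>n\<ge>N. g n u = 0)" if x: "x \<in> topspace X" for x
  proof -
    obtain m where m: "f m x > 0" using first[OF x] by blast
    define U where "U = {u \<in> topspace X. f m u \<in> {f m x / 2 <..}}"
    \<comment> \<open>On \<open>U\<close> the value of \<open>f m\<close> exceeds half of
      \<open>f m x\<close>, so from this \<open>N\<close> on, and past \<open>m\<close>, the
      subtracted term is at least 1 and cancels \<open>f n\<close>.\<close>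
    obtain N where N: "real N > 2 / f m x" using reals_Archimedean2 by blast
    have "g n u = 0" if u: "u \<in> U" and n: "n \<ge> max N (Suc m)" for u n
    proof -
      have "f m x / 2 \<le> mx n u" using u mx_ge[of m n u] n by (auto simp: U_def)
      moreover have "2 / f m x \<le> real n" using N n by linarith
      ultimately have "(2 / f m x) * (f m x / 2) \<le> real n * mx n u"
        using m by (intro mult_mono) auto
      then have "1 \<le> real n * mx n u" using m by simp
      then show ?thesis using f01[of u n] u by (simp add: g_def U_def)
    qed
    moreover have "openin X U"
      unfolding U_def by (rule openin_continuous_map_preimage[OF cont]) simp
    moreover have "x \<in> U" using x m by (simp add: U_def)
    ultimately show ?thesis by blast
  qed
  define S where "S x = (\<Sum>n. g n x)" for x
  have Seq: "S u = (\<Sum>n<N. g n u)" if "\<forall>n\<ge>N. g n u = 0" for u N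
    unfolding S_def by (rule suminf_finite) (use that in auto)
  have Spos: "S x > 0" if x: "x \<in> topspace X" for x
  proof -
    obtain m where m: "g m x > 0" using first[OF x] by blast
    obtain N where N: "\<forall>n\<ge>N. g n x = 0" using loc[OF x] by blast
    have "m < N" using m N by (metis less_irrefl not_less)
    then have "g m x \<le> (\<Sum>n<N. g n x)" by (intro member_le_sum) (auto simp: g0)
    then show ?thesis using m Seq[OF N] by simp
  qed
  have Sc: "continuous_map X euclideanreal S"
  proof (rule continuous_map_locally)
    fix x assume x: "x \<in> topspace X"
    obtain U N where U: "openin X U" "x \<in> U" "\<forall>u\<in>U. \<forall>n\<ge>N. g n u = 0" using loc[OF x] by blast
    have "continuous_map (subtopology X U) euclideanreal (\<lambda>u. \<Sum>n<N. g n u)"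
      by (intro continuous_map_sum continuous_map_from_subtopology gc) auto
    then have "continuous_map (subtopology X U) euclideanreal S"
      by (rule continuous_map_eq) (use U Seq in auto)
    then show "\<exists>U. openin X U \<and> x \<in> U \<and> continuous_map (subtopology X U) euclideanreal S"
      using U by blast
  qed
  show thesis
  proof (rule that[of "\<lambda>n x. g n x / S x"])
    show "continuous_map X euclideanreal (\<lambda>x. g n x / S x)" for n
      using Spos by (intro continuous_map_real_divide gc Sc) force
    show "\<exists>U N. openin X U \<and> x \<in> U \<and>
       (\<forall>u\<in>U. (\<forall>n\<ge>N. g n u / S u = 0) \<and> (\<Sum>n<N. g n u / S u) = 1)" if x: "x \<in> topspace X" for x
    proof -
      obtain U N where U: "openin X U" "x \<in> U" "\<forall>u\<in>U. \<forall>n\<ge>N. g n u = 0" using loc[OF x] by blast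
      have "(\<Sum>n<N. g n u / S u) = 1" if "u \<in> U" for u
      proof -
        have "u \<in> topspace X" using that openin_subset[OF U(1)] by blast
        then have "S u > 0" by (rule Spos)
        then show ?thesis using Seq[of N u] U(3) that by (simp flip: sum_divide_distrib)
      qed
      then show ?thesis using U by (intro exI[of _ U] exI[of _ N]) auto
    qed
  qed (use g0 gf Spos in \<open>auto simp: less_imp_le\<close>)
qed

section \<open>Averaging homotopies over nearby parameters\<close>

lemma (in Metric_space) continuous_map_dist_from:
  assumes "a \<in> M"
  shows "continuous_map mtopology euclideanreal (d a)"
proof -
  have "\<exists>\<delta>>0. \<forall>x. x \<in> M \<and> d y x < \<delta> \<longrightarrow> dist (d a y) (d a x) < \<epsilon>" if "y \<in> M" "\<epsilon> > 0" for y \<epsilon>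
  proof (intro exI[of _ \<epsilon>] conjI allI impI)
    fix x assume "x \<in> M \<and> d y x < \<epsilon>"
    then show "dist (d a y) (d a x) < \<epsilon>"
      using triangle[of a y x] triangle[of a x y] commute[of x y] assms that(1)
      by (auto simp: dist_real_def)
  qed (use that in auto)
  then have "continuous_map mtopology Met_TC.mtopology (d a)"
    by (subst metric_continuous_map[OF Met_TC.Metric_space_axioms]) auto
  then show ?thesis by simp
qed

lemma openin_norm_diff_less:
  fixes f :: "'a \<Rightarrow> 'b::real_normed_vector"
  assumes "continuous_map X euclidean f" "continuous_map X euclidean g"
  shows "openin X {x \<in> topspace X. norm (f x - g x) < e}"
  using openin_continuous_map_preimage[OF continuous_map_norm[OF continuous_map_diff[OF assms]],
      of "{..<e}"] by simp

text \<open>The homotopy \<open>h\<close> on the arbitrary subset \<open>V\<close> is replaced by an average of the paths \<open>h a\<close> at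
  nearby points \<open>a\<close> of \<open>V\<close>, which makes sense on a neighbourhood of \<open>V\<close>. On the first and on
  the last third of the interval the average is joined by segments to the prescribed end points.
  The radius at \<open>a\<close> is such that \<open>G\<close> contains the \<open>\<epsilon> a\<close>-neighbourhood of the path \<open>h a\<close>; among the
  finitely many \<open>a\<close> relevant at a point, the one of largest radius controls the others.\<close>

lemma homotopy_approximation_open:
  fixes h :: "'a \<times> real \<Rightarrow> 'n::real_normed_vector"
  assumes X: "metrizable_space X" "second_countable X" and VX: "V \<subseteq> topspace X"
    and Z: "convex Z"
    and h: "continuous_map (prod_topology (subtopology X V) unit_interval) (top_of_set Z) h"
    and e1: "continuous_map X (top_of_set Z) e1" and e2: "continuous_map X (top_of_set Z) e2"
    and h0: "\<And>a. a \<in> V \<Longrightarrow> h (a, 0) = e1 a" and h1: "\<And>a. a \<in> V \<Longrightarrow> h (a, 1) = e2 a"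
    and G: "openin (prod_topology X (top_of_set Z)) G"
    and hG: "\<And>a t. a \<in> V \<Longrightarrow> t \<in> {0..1} \<Longrightarrow> (a, h (a, t)) \<in> G"
  obtains W K where "openin X W" "V \<subseteq> W"
    "continuous_map (prod_topology (subtopology X W) unit_interval) (top_of_set Z) K"
    "\<And>v. v \<in> W \<Longrightarrow> K (v, 0) = e1 v" "\<And>v. v \<in> W \<Longrightarrow> K (v, 1) = e2 v"
    "\<And>v t. v \<in> W \<Longrightarrow> t \<in> {0..1} \<Longrightarrow> (v, K (v, t)) \<in> G"
proof (cases "V = {}")
  case True
  then show thesis by (intro that[of "{}" "\<lambda>_. undefined"]) (auto simp: continuous_map_def)
next
  case False
  obtain M d where "Metric_space M d" and XM: "X = Metric_space.mtopology M d"
    using X by (auto simp: metrizable_space_def)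
  then interpret Metric_space M d by simp
  have VM: "V \<subseteq> M" using VX by (simp add: XM)
  have he: "continuous_map (prod_topology (subtopology X V) unit_interval) euclidean h"
    and hZ: "\<And>a t. a \<in> V \<Longrightarrow> t \<in> {0..1} \<Longrightarrow> h (a, t) \<in> Z"
    using h VX by (auto simp: continuous_map_in_subtopology image_subset_iff Pi_iff)
  have e1e: "continuous_map X euclidean e1" and e1Z: "\<And>v. v \<in> M \<Longrightarrow> e1 v \<in> Z"
    and e2e: "continuous_map X euclidean e2" and e2Z: "\<And>v. v \<in> M \<Longrightarrow> e2 v \<in> Z"
    using e1 e2 by (auto simp: continuous_map_in_subtopology XM)
  \<comment> \<open>Within \<open>\<delta>\<close> of \<open>a\<close> the end points, and over
    \<open>V\<close> also the paths \<open>h\<close>, move by less than \<open>\<epsilon>\<close>,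
    and the clearance \<open>\<epsilon>\<close> of the path \<open>h a\<close> inside
    \<open>G\<close> persists.\<close>
  define good where "good a \<epsilon> \<delta> \<longleftrightarrow> \<epsilon> > 0 \<and> \<delta> > 0 \<and>
     (\<forall>v\<in>mball a \<delta>. norm (e1 v - e1 a) < \<epsilon> \<and> norm (e2 v - e2 a) < \<epsilon> \<and>
       (\<forall>t\<in>{0..1}. \<forall>z\<in>Z. norm (z - h (a, t)) < \<epsilon> \<longrightarrow> (v, z) \<in> G) \<and>
       (v \<in> V \<longrightarrow> (\<forall>t\<in>{0..1}. norm (h (v, t) - h (a, t)) < \<epsilon>)))" for a \<epsilon> \<delta>
  have "\<exists>\<epsilon> \<delta>. good a \<epsilon> \<delta>" if a: "a \<in> V" for a
  proof -
    have ha: "continuous_map unit_interval (top_of_set Z) (\<lambda>t. h (a, t))"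
      by (rule continuous_map_slice[OF h]) (use a VX in auto)
    have kc: "compactin (top_of_set Z) ((\<lambda>t. h (a, t)) ` {0..1})"
      by (rule image_compactin[OF _ ha]) (simp add: compactin_subtopology)
    have aG: "{a} \<times> (\<lambda>t. h (a, t)) ` {0..1} \<subseteq> G" using hG a by auto
    obtain U O' where U: "openin X U" "a \<in> U" and O': "openin (top_of_set Z) O'"
      and kO: "(\<lambda>t. h (a, t)) ` {0..1} \<subseteq> O'" and UO: "U \<times> O' \<subseteq> G"
      using tube_lemma_right[OF G kc _ aG] a VX by blast
    obtain O'' where O'': "open O''" "O' = Z \<inter> O''" using O' by (auto simp: openin_open)
    have "compact ((\<lambda>t. h (a, t)) ` {0..1})"
      using kc by (simp add: compactin_subtopology)
    then obtain \<epsilon> where \<epsilon>: "\<epsilon> > 0" "(\<Union>x\<in>(\<lambda>t. h (a, t)) ` {0..1}. ball x \<epsilon>) \<subseteq> O''"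
      using compact_subset_open_imp_ball_epsilon_subset[OF _ O''(1)] kO O''(2) by blast
    have z: "(v, z) \<in> G" if "v \<in> U" "t \<in> {0..1}" "z \<in> Z" "norm (z - h (a, t)) < \<epsilon>" for v t z
    proof -
      have "z \<in> ball (h (a, t)) \<epsilon>" using that by (simp add: dist_norm norm_minus_commute)
      then have "z \<in> O''" using \<epsilon>(2) that(2) by blast
      then show ?thesis using UO that O''(2) by blast
    qed
    define U1 where "U1 = {v \<in> topspace X. norm (e1 v - e1 a) < \<epsilon>}"
    define U2 where "U2 = {v \<in> topspace X. norm (e2 v - e2 a) < \<epsilon>}"
    have U12: "openin X U1" "openin X U2" "a \<in> U1" "a \<in> U2"
      unfolding U1_def U2_def using a VX \<epsilon>(1)
      by (auto intro!: openin_norm_diff_less e1e e2e)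
    let ?P = "prod_topology (subtopology X V) unit_interval"
    have hs: "continuous_map ?P euclidean (\<lambda>z. h (a, snd z))"
      using continuous_map_compose[OF continuous_map_snd continuous_map_top_of_setD[OF ha]]
      by (simp add: o_def)
    have "openin (subtopology X V) {v \<in> topspace (subtopology X V). \<forall>t\<in>{0..1}.
        (v, t) \<in> {z \<in> topspace ?P. norm (h z - h (a, snd z)) < \<epsilon>}}"
      by (rule openin_forall_unit_interval[OF openin_norm_diff_less[OF he hs]])
    then obtain U3 where U3: "openin X U3" "{v \<in> topspace (subtopology X V). \<forall>t\<in>{0..1}.
        (v, t) \<in> {z \<in> topspace ?P. norm (h z - h (a, snd z)) < \<epsilon>}} = U3 \<inter> V"
      unfolding openin_subtopology by blast
    have u3: "norm (h (v, t) - h (a, t)) < \<epsilon>" if "v \<in> U3" "v \<in> V" "t \<in> {0..1}" for v t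
    proof -
      have "v \<in> U3 \<inter> V" using that by blast
      then have "(v, t) \<in> {z \<in> topspace ?P. norm (h z - h (a, snd z)) < \<epsilon>}"
        using that(3) unfolding U3(2)[symmetric] by blast
      then show ?thesis by simp
    qed
    have "a \<in> {v \<in> topspace (subtopology X V). \<forall>t\<in>{0..1}.
        (v, t) \<in> {z \<in> topspace ?P. norm (h z - h (a, snd z)) < \<epsilon>}}"
      using a VX \<epsilon>(1) by auto
    then have "a \<in> U3" using U3(2) by blast
    then have "openin X (U \<inter> U1 \<inter> U2 \<inter> U3)" "a \<in> U \<inter> U1 \<inter> U2 \<inter> U3"
      using U U12 U3(1) by auto
    then obtain \<delta> where "\<delta> > 0" "mball a \<delta> \<subseteq> U \<inter> U1 \<inter> U2 \<inter> U3"
      unfolding XM openin_mtopology by blast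
    then have "good a \<epsilon> \<delta>"
      unfolding good_def using \<epsilon>(1) z u3 by (auto simp: U1_def U2_def subset_iff)
    then show ?thesis by blast
  qed
  then obtain \<epsilon> \<delta> where good: "\<And>a. a \<in> V \<Longrightarrow> good a (\<epsilon> a) (\<delta> a)" by metis
  \<comment> \<open>Half radii are used so that two centres relevant at the same point are closer to
    each other than the larger of their radii; the centre with the smaller radius then lies in the
    full ball around the other.\<close>
  define W where "W = (\<Union>a\<in>V. mball a (\<delta> a / 2))"
  have \<delta>: "\<delta> a > 0" if "a \<in> V" for a using good[OF that] by (simp add: good_def)
  have oW: "openin X W" by (auto simp: W_def XM)
  have VW: "V \<subseteq> W" using \<delta> VM by (force simp: W_def in_mball)
  have WM: "W \<subseteq> M" using openin_subset[OF oW] by (simp add: XM)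
  \<comment> \<open>Countably many centres suffice, which allows the use of a partition of unity
    indexed by the naturals.\<close>
  have "Lindelof_space (subtopology X W)"
    using X(2) second_countable_subtopology second_countable_imp_Lindelof_space by blast
  then have "(\<forall>U\<in>(\<lambda>a. mball a (\<delta> a / 2)) ` V. openin X U) \<and> W \<subseteq> \<Union> ((\<lambda>a. mball a (\<delta> a / 2)) ` V) \<longrightarrow>
      (\<exists>\<V>. countable \<V> \<and> \<V> \<subseteq> (\<lambda>a. mball a (\<delta> a / 2)) ` V \<and> W \<subseteq> \<Union>\<V>)"
    unfolding Lindelof_space_subtopology_subset[OF openin_subset[OF oW]] by (rule spec)
  moreover have "\<forall>U\<in>(\<lambda>a. mball a (\<delta> a / 2)) ` V. openin X U" by (auto simp: XM)
  moreover have "W \<subseteq> \<Union> ((\<lambda>a. mball a (\<delta> a / 2)) ` V)" by (simp add: W_def)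
  ultimately have "\<exists>\<V>. countable \<V> \<and> \<V> \<subseteq> (\<lambda>a. mball a (\<delta> a / 2)) ` V \<and> W \<subseteq> \<Union>\<V>"
    by simp
  then obtain A where A: "countable A" "A \<subseteq> V" "W \<subseteq> (\<Union>a\<in>A. mball a (\<delta> a / 2))"
    unfolding ex_countable_subset_image by blast
  have "A \<noteq> {}" using A(3) VW False by auto
  define a where "a = from_nat_into A"
  have aV: "a n \<in> V" for n using A(2) from_nat_into[OF \<open>A \<noteq> {}\<close>] by (auto simp: a_def)
  have aM: "a n \<in> M" for n using aV VM by blast
  have aW: "\<exists>n. v \<in> mball (a n) (\<delta> (a n) / 2)" if v: "v \<in> W" for v
  proof -
    obtain b where "b \<in> A" "v \<in> mball b (\<delta> b / 2)" using A(3) v by blast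
    then show ?thesis using from_nat_into_surj[OF A(1), of b] by (auto simp: a_def)
  qed
  define f where "f n v = max 0 (min 1 (\<delta> (a n) / 2 - d (a n) v))" for n v
  have "\<And>n. continuous_map (subtopology X W) euclideanreal (f n)"
    unfolding f_def XM
    by (intro continuous_map_real_max continuous_map_real_min continuous_map_diff
        continuous_map_from_subtopology continuous_map_dist_from aM) auto
  moreover have "\<And>n v. f n v \<in> {0..1}" by (auto simp: f_def)
  moreover have "\<exists>n. f n v > 0" if v: "v \<in> topspace (subtopology X W)" for v
  proof -
    have "v \<in> W" using v by simp
    then obtain n where "v \<in> mball (a n) (\<delta> (a n) / 2)" using aW by blast
    then show ?thesis by (intro exI[of _ n]) (auto simp: f_def in_mball)
  qed
  ultimately obtain w where wc: "\<And>n. continuous_map (subtopology X W) euclideanreal (w n)"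
    and w0: "\<And>n x. x \<in> topspace (subtopology X W) \<Longrightarrow> w n x \<ge> 0"
    and wf: "\<And>n x. x \<in> topspace (subtopology X W) \<Longrightarrow> w n x \<noteq> 0 \<Longrightarrow> f n x > 0"
    and wloc: "\<And>x. x \<in> topspace (subtopology X W) \<Longrightarrow> \<exists>U N. openin (subtopology X W) U \<and> x \<in> U \<and>
       (\<forall>u\<in>U. (\<forall>n\<ge>N. w n u = 0) \<and> (\<Sum>n<N. w n u) = (1::real))"
    by (rule countable_partition_of_unity[of "subtopology X W" f]) blast+
  have tW: "topspace (subtopology X W) = W" using WM by (auto simp: XM)
  \<comment> \<open>The averaged paths are run through on the middle third and rest on the outer
    thirds. There the prescribed end points and the average lie in a common ball, centred at an end
    point of one of the paths, so the segments between them stay in that ball.\<close>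
  define q :: "real \<Rightarrow> real" where "q t = max 0 (min 1 (3 * t - 1))" for t
  have q01: "q t \<in> {0..1}" for t by (simp add: q_def)
  define L where "L = (\<lambda>(v, t). \<Sum>n. w n v *\<^sub>R h (a n, q t))"
  have Leq: "L (v, t) = (\<Sum>n<N. w n v *\<^sub>R h (a n, q t))" if "\<forall>n\<ge>N. w n v = 0" for v t N
    unfolding L_def prod.case by (rule suminf_finite) (use that in auto)
  have near: "\<exists>b\<in>V. \<exists>\<epsilon>>0. (\<forall>t\<in>{0..1}. L (v, t) \<in> Z \<inter> ball (h (b, q t)) \<epsilon>) \<and>
      e1 v \<in> Z \<inter> ball (h (b, 0)) \<epsilon> \<and> e2 v \<in> Z \<inter> ball (h (b, 1)) \<epsilon> \<and>
      (\<forall>t\<in>{0..1}. \<forall>z\<in>Z \<inter> ball (h (b, t)) \<epsilon>. (v, z) \<in> G)" if v: "v \<in> W" for v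
  proof -
    obtain N where N: "\<forall>n\<ge>N. w n v = 0" "(\<Sum>n<N. w n v) = 1" using wloc[of v] v tW by blast
    define J where "J = {n \<in> {..<N}. w n v \<noteq> 0}"
    have J: "finite J" by (simp add: J_def)
    have "(\<Sum>n\<in>J. w n v) = (\<Sum>n<N. w n v)"
      unfolding J_def by (rule sum.mono_neutral_left) auto
    with N(2) have J1: "(\<Sum>n\<in>J. w n v) = 1" by simp
    \<comment> \<open>The centre of largest radius among those of nonzero weight is chosen as
      \<open>b\<close>; all the other averaged paths are within its
      \<open>\<epsilon>\<close>.\<close>
    then have "J \<noteq> {}" by auto
    then have "Max ((\<lambda>n. \<delta> (a n)) ` J) \<in> (\<lambda>n. \<delta> (a n)) ` J" using J by (intro Max_in) auto
    then obtain m where m: "m \<in> J" "Max ((\<lambda>n. \<delta> (a n)) ` J) = \<delta> (a m)" by auto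
    have mmax: "\<delta> (a n) \<le> \<delta> (a m)" if "n \<in> J" for n
      using Max_ge[of "(\<lambda>n. \<delta> (a n)) ` J" "\<delta> (a n)"] J that m(2) by auto
    have dJ: "d (a n) v < \<delta> (a n) / 2" if "n \<in> J" for n
    proof -
      have "f n v > 0" using wf[of v n] that v unfolding tW by (simp add: J_def)
      then show ?thesis by (simp add: f_def max_def split: if_splits)
    qed
    have vM: "v \<in> M" using v WM by blast
    have gm: "good (a m) (\<epsilon> (a m)) (\<delta> (a m))" by (rule good[OF aV])
    then have \<epsilon>m: "\<epsilon> (a m) > 0" by (simp add: good_def)
    have vb: "v \<in> mball (a m) (\<delta> (a m))"
      using dJ[OF m(1)] \<delta>[OF aV, of m] vM aM by (auto simp: in_mball)
    have anb: "a n \<in> mball (a m) (\<delta> (a m))" if n: "n \<in> J" for n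
      using dJ[OF m(1)] dJ[OF n] mmax[OF n] triangle[of "a m" v "a n"] commute[of v "a n"] vM aM
      by (auto simp: in_mball)
    show ?thesis
    proof (intro bexI[OF _ aV[of m]] exI[of _ "\<epsilon> (a m)"] conjI ballI)
      fix t :: real
      let ?C = "Z \<inter> ball (h (a m, q t)) (\<epsilon> (a m))"
      have "L (v, t) = (\<Sum>n\<in>J. w n v *\<^sub>R h (a n, q t))"
        unfolding Leq[OF N(1)] J_def by (rule sum.mono_neutral_right) auto
      moreover have "(\<Sum>n\<in>J. w n v *\<^sub>R h (a n, q t)) \<in> ?C"
      proof (rule convex_sum[OF J _ J1])
        show "convex ?C" using Z by (intro convex_Int convex_ball)
        show "0 \<le> w n v" if "n \<in> J" for n using w0[of v n] v unfolding tW by simp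
        fix n assume "n \<in> J"
        then have "norm (h (a n, q t) - h (a m, q t)) < \<epsilon> (a m)"
          using gm anb[of n] aV[of n] q01[of t] by (auto simp: good_def)
        then show "h (a n, q t) \<in> ?C"
          using hZ[OF aV[of n] q01[of t]] by (simp add: dist_norm norm_minus_commute)
      qed
      ultimately show "L (v, t) \<in> ?C" by simp
    next
      show "e1 v \<in> Z \<inter> ball (h (a m, 0)) (\<epsilon> (a m))" "e2 v \<in> Z \<inter> ball (h (a m, 1)) (\<epsilon> (a m))"
        using gm vb e1Z[OF vM] e2Z[OF vM] h0[OF aV, of m] h1[OF aV, of m]
        by (auto simp: good_def dist_norm norm_minus_commute)
    next
      fix t :: real and z assume "t \<in> {0..1}" "z \<in> Z \<inter> ball (h (a m, t)) (\<epsilon> (a m))"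
      then show "(v, z) \<in> G" using gm vb by (auto simp: good_def dist_norm norm_minus_commute)
    qed (rule \<epsilon>m)
  qed
  define K where "K = (\<lambda>(v, t). max 0 (1 - 3 * t) *\<^sub>R e1 v + max 0 (3 * t - 2) *\<^sub>R e2 v +
      (1 - max 0 (1 - 3 * t) - max 0 (3 * t - 2)) *\<^sub>R L (v, t))"
  \<comment> \<open>At most one of the two end point weights is nonzero at any time, so an end point
    has to lie in \<open>C\<close> only on the third where it enters the combination.\<close>
  have KC: "K (v, t) \<in> C" if "convex C" "t \<in> {0..1}" "L (v, t) \<in> C" "t \<le> 1/3 \<Longrightarrow> e1 v \<in> C"
    "t \<ge> 2/3 \<Longrightarrow> e2 v \<in> C" for v t C
  proof -
    consider "t \<le> 1/3" | "t \<ge> 1/3" "t \<le> 2/3" | "t \<ge> 2/3" by linarith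
    then show ?thesis
    proof cases
      case 1
      then have "K (v, t) = (1 - 3 * t) *\<^sub>R e1 v + (3 * t) *\<^sub>R L (v, t)" by (simp add: K_def)
      also have "\<dots> \<in> C" using that 1 by (intro convexD) auto
      finally show ?thesis .
    next
      case 2
      then show ?thesis using that by (simp add: K_def)
    next
      case 3
      then have "K (v, t) = (3 * t - 2) *\<^sub>R e2 v + (3 - 3 * t) *\<^sub>R L (v, t)" by (simp add: K_def)
      also have "\<dots> \<in> C" using that 3 by (intro convexD) auto
      finally show ?thesis .
    qed
  qed
  have KG: "K (v, t) \<in> Z" "(v, K (v, t)) \<in> G" if v: "v \<in> W" and t: "t \<in> {0..1}" for v t
  proof -
    obtain b \<epsilon> where "b \<in> V" and L: "L (v, t) \<in> Z \<inter> ball (h (b, q t)) \<epsilon>"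
      and e: "e1 v \<in> Z \<inter> ball (h (b, 0)) \<epsilon>" "e2 v \<in> Z \<inter> ball (h (b, 1)) \<epsilon>"
      and G: "\<And>z t. t \<in> {0..1} \<Longrightarrow> z \<in> Z \<inter> ball (h (b, t)) \<epsilon> \<Longrightarrow> (v, z) \<in> G"
      using near[OF v] t by blast
    have "K (v, t) \<in> Z \<inter> ball (h (b, q t)) \<epsilon>"
    proof (rule KC[OF _ t L])
      show "convex (Z \<inter> ball (h (b, q t)) \<epsilon>)" using Z by (intro convex_Int convex_ball)
      show "e1 v \<in> Z \<inter> ball (h (b, q t)) \<epsilon>" if "t \<le> 1/3"
      proof -
        have "q t = 0" using that by (simp add: q_def)
        then show ?thesis using e(1) by simp
      qed
      show "e2 v \<in> Z \<inter> ball (h (b, q t)) \<epsilon>" if "t \<ge> 2/3"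
      proof -
        have "q t = 1" using that by (simp add: q_def)
        then show ?thesis using e(2) by simp
      qed
    qed
    then show "K (v, t) \<in> Z" "(v, K (v, t)) \<in> G" using G[OF q01[of t]] by auto
  qed
  let ?Q = "prod_topology (subtopology X W) unit_interval"
  have sc: "continuous_map ?Q euclideanreal snd"
    by (rule continuous_map_top_of_setD[OF continuous_map_snd])
  have fc: "continuous_map ?Q (subtopology X W) fst" by (rule continuous_map_fst)
  have Lc: "continuous_map ?Q euclidean L"
  \<comment> \<open>The series defining \<open>L\<close> is locally a finite sum with a fixed number
    of terms.\<close>
  proof (rule continuous_map_locally)
    fix x assume "x \<in> topspace ?Q"
    then obtain v t where x: "x = (v, t)" "v \<in> W" "t \<in> {0..1}" using tW by auto
    obtain U N where U: "openin (subtopology X W) U" "v \<in> U"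
      and UN: "\<forall>u\<in>U. (\<forall>n\<ge>N. w n u = 0) \<and> (\<Sum>n<N. w n u) = (1::real)"
      using wloc[of v] x(2) tW by blast
    let ?R = "subtopology ?Q (U \<times> {0..1})"
    have q: "continuous_map ?Q unit_interval (\<lambda>z. q (snd z))"
      using q01 unfolding continuous_map_unit_interval_iff q_def
      by (auto intro!: continuous_map_real_max continuous_map_real_min continuous_map_diff
          continuous_map_real_mult sc)
    have "continuous_map ?Q euclidean (\<lambda>z. h (a n, q (snd z)))" for n
    proof -
      have "continuous_map ?Q (prod_topology (subtopology X V) unit_interval) (\<lambda>z. (a n, q (snd z)))"
        using q aV[of n] VX by (auto simp: continuous_map_pairwise o_def)
      from continuous_map_compose[OF this he] show ?thesis by (simp add: o_def)
    qed
    moreover have "continuous_map ?Q euclideanreal (\<lambda>z. w n (fst z))" for n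
      using continuous_map_compose[OF fc wc] by (simp add: o_def)
    ultimately have "continuous_map ?R euclidean (\<lambda>z. \<Sum>n<N. w n (fst z) *\<^sub>R h (a n, q (snd z)))"
      by (intro continuous_map_sum continuous_map_from_subtopology continuous_map_scaleR) auto
    then have "continuous_map ?R euclidean L"
      by (rule continuous_map_eq) (use UN in \<open>auto simp: Leq\<close>)
    moreover have "openin ?Q (U \<times> {0..1})" using U(1) by (simp add: openin_prod_Times_iff)
    ultimately show "\<exists>U. openin ?Q U \<and> x \<in> U \<and> continuous_map (subtopology ?Q U) euclidean L"
      using U(2) x by (intro exI[of _ "U \<times> {0..1}"]) auto
  qed
  have ec: "continuous_map ?Q euclidean (\<lambda>z. e1 (fst z))" "continuous_map ?Q euclidean (\<lambda>z. e2 (fst z))"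
    using continuous_map_compose[OF fc continuous_map_from_subtopology[OF e1e]]
      continuous_map_compose[OF fc continuous_map_from_subtopology[OF e2e]]
    by (simp_all add: o_def)
  have "continuous_map ?Q euclidean K"
    unfolding K_def case_prod_unfold prod.collapse
    by (intro continuous_map_add continuous_map_scaleR ec Lc continuous_map_real_max
        continuous_map_diff continuous_map_real_mult sc) auto
  then have "continuous_map ?Q (top_of_set Z) K"
    using KG(1) tW by (auto simp: continuous_map_in_subtopology)
  moreover have "K (v, 0) = e1 v" "K (v, 1) = e2 v" for v by (simp_all add: K_def)
  ultimately show thesis using that[OF oW VW] KG(2) by blast
qed

section \<open>Fibrewise motions\<close>

lemma continuous_map_compose_fun:
  assumes "continuous_map Y Z g" "continuous_map X Y f"
  shows "continuous_map X Z (\<lambda>x. g (f x))"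
  using continuous_map_compose[OF assms(2,1)] by (simp add: o_def)

text \<open>A section of the path fibration in uncurried form. The set \<open>V\<close> is an
  arbitrary subset, so that the motions glued from the fibre and their extensions to open sets are
  treated alike; values off \<open>V \<times> [0,1]\<close> are irrelevant.\<close>

definition fibre_motion ::
  "'e topology \<Rightarrow> ('e \<Rightarrow> 'b) \<Rightarrow> ('e \<times> 'e) set \<Rightarrow> (('e \<times> 'e) \<times> real \<Rightarrow> 'e) \<Rightarrow> bool" where
  "fibre_motion E p V h \<longleftrightarrow> V \<subseteq> topspace (fib_prod E p) \<and>
    continuous_map (prod_topology (subtopology (fib_prod E p) V) unit_interval) E h \<and>
    (\<forall>v\<in>V. h (v, 0) = fst v \<and> h (v, 1) = snd v \<and> (\<forall>t\<in>{0..1}. p (h (v, t)) = p (fst v)))"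

lemma topspace_fib_prod: "topspace (fib_prod E p) = {(x, y) \<in> topspace E \<times> topspace E. p x = p y}"
  by (auto simp: fib_prod_def)

lemma continuous_map_fib_prod_fst: "continuous_map (fib_prod E p) E fst"
  and continuous_map_fib_prod_snd: "continuous_map (fib_prod E p) E snd"
  unfolding fib_prod_def
  by (simp_all add: continuous_map_from_subtopology continuous_map_fst continuous_map_snd)

lemma continuous_map_into_fib_prod:
  assumes "continuous_map X E f" "continuous_map X E g"
    "\<And>x. x \<in> topspace X \<Longrightarrow> p (f x) = p (g x)"
  shows "continuous_map X (fib_prod E p) (\<lambda>x. (f x, g x))"
  using assms by (auto simp: fib_prod_def continuous_map_in_subtopology continuous_map_pairwise o_def)

lemma section_over_imp_fibre_motion:
  assumes s: "section_over (fib_path_space E p) (fib_prod E p) endpoints V s"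
  shows "fibre_motion E p V (\<lambda>(v, t). s v t)"
proof -
  have V: "V \<subseteq> topspace (fib_prod E p)"
    and c: "continuous_map (subtopology (fib_prod E p) V) (fib_path_space E p) s"
    and e: "\<And>v. v \<in> V \<Longrightarrow> endpoints (s v) = v"
    using s by (auto simp: section_over_def)
  have c': "continuous_map (subtopology (fib_prod E p) V) (path_space E) s"
    and b: "\<And>v. v \<in> V \<Longrightarrow> \<exists>b. \<forall>t\<in>{0..1}. p (s v t) = b"
    using c V by (auto simp: fib_path_space_def continuous_map_in_subtopology image_subset_iff)
  have ends: "s v 0 = fst v" "s v 1 = snd v" if "v \<in> V" for v
    using e[OF that] by (auto simp: endpoints_def prod_eq_iff)
  have "p (s v t) = p (fst v)" if v: "v \<in> V" and t: "t \<in> {0..1}" for v t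
  proof -
    obtain b where b: "\<forall>t\<in>{0..1}. p (s v t) = b" using b[OF v] by blast
    then have "p (s v 0) = b" "p (s v t) = b" using t by auto
    then show ?thesis using ends(1)[OF v] by simp
  qed
  then show ?thesis
    using V continuous_map_path_eval[OF c'] ends by (simp add: fibre_motion_def)
qed

lemma fibre_motion_imp_section_over:
  assumes h: "fibre_motion E p V h"
  shows "section_over (fib_path_space E p) (fib_prod E p) endpoints V (\<lambda>v. \<lambda>t\<in>{0..1}. h (v, t))"
proof -
  have V: "V \<subseteq> topspace (fib_prod E p)"
    and c: "continuous_map (prod_topology (subtopology (fib_prod E p) V) unit_interval) E h"
    and e: "\<And>v. v \<in> V \<Longrightarrow> h (v, 0) = fst v \<and> h (v, 1) = snd v"
    and ph: "\<And>v t. v \<in> V \<Longrightarrow> t \<in> {0..1} \<Longrightarrow> p (h (v, t)) = p (fst v)"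
    using h unfolding fibre_motion_def by blast+
  have "(\<lambda>v. \<lambda>t\<in>{0..1}. h (v, t)) \<in> topspace (subtopology (fib_prod E p) V) \<rightarrow>
      {\<gamma>. \<exists>b. \<forall>t\<in>{0..1}. p (\<gamma> t) = b}"
  proof
    fix v assume "v \<in> topspace (subtopology (fib_prod E p) V)"
    then have "\<forall>t\<in>{0..1}. p ((\<lambda>t\<in>{0..1}. h (v, t)) t) = p (fst v)" by (simp add: ph)
    then show "(\<lambda>t\<in>{0..1}. h (v, t)) \<in> {\<gamma>. \<exists>b. \<forall>t\<in>{0..1}. p (\<gamma> t) = b}" by blast
  qed
  then have "continuous_map (subtopology (fib_prod E p) V) (fib_path_space E p) (\<lambda>v. \<lambda>t\<in>{0..1}. h (v, t))"
    unfolding fib_path_space_def continuous_map_in_subtopology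
    using continuous_map_into_path_space[OF c] by (intro conjI)
  then show ?thesis
    using V e by (auto simp: section_over_def endpoints_def)
qed

section \<open>Pushing homotopies back into the fibres\<close>

text \<open>A path \<open>K y\<close> that stays near the fibre over \<open>b y\<close> is pushed into that fibre by lifting the
  short paths from \<open>p (K (y, t))\<close> to \<open>b y\<close>. These are constant for \<open>t = 0, 1\<close>, so regularity of the
  lift fixes the end points.\<close>

lemma fibre_homotopy_correction:
  fixes Y :: "'y topology" and E :: "'e topology" and B :: "'b topology"
  assumes p: "hurewicz_fibration E B p"
    and c: "continuous_map (prod_topology (subtopology (prod_topology B B) N) unit_interval) B c"
    and c0: "\<And>x y. (x, y) \<in> N \<Longrightarrow> c ((x, y), 0) = x"
    and c1: "\<And>x y. (x, y) \<in> N \<Longrightarrow> c ((x, y), 1) = y"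
    and cd: "\<And>x t. x \<in> topspace B \<Longrightarrow> c ((x, x), t) = x"
    and K: "continuous_map (prod_topology Y unit_interval) E K"
    and b: "continuous_map Y B b"
    and near: "\<And>y t. y \<in> topspace Y \<Longrightarrow> t \<in> {0..1} \<Longrightarrow> (p (K (y, t)), b y) \<in> N"
    and ends: "\<And>y. y \<in> topspace Y \<Longrightarrow> p (K (y, 0)) = b y"
      "\<And>y. y \<in> topspace Y \<Longrightarrow> p (K (y, 1)) = b y"
    and m: "continuous_map Y unit_interval m"
    and Km: "\<And>y t. y \<in> topspace Y \<Longrightarrow> m y = 0 \<Longrightarrow> t \<in> {0..1} \<Longrightarrow> K (y, t) = K (y, 0)"
  obtains K' where "continuous_map (prod_topology Y unit_interval) E K'"
    "\<And>y. y \<in> topspace Y \<Longrightarrow> K' (y, 0) = K (y, 0)"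
    "\<And>y. y \<in> topspace Y \<Longrightarrow> K' (y, 1) = K (y, 1)"
    "\<And>y t. y \<in> topspace Y \<Longrightarrow> t \<in> {0..1} \<Longrightarrow> p (K' (y, t)) = b y"
    "\<And>y t. y \<in> topspace Y \<Longrightarrow> m y = 0 \<Longrightarrow> t \<in> {0..1} \<Longrightarrow> K' (y, t) = K (y, 0)"
proof -
  let ?YI = "prod_topology Y unit_interval"
  let ?YII = "prod_topology ?YI unit_interval"
  have pc: "continuous_map E B p" using p by (simp add: hurewicz_fibration_def)
  have bB: "b y \<in> topspace B" if "y \<in> topspace Y" for y
    using continuous_map_image_subset_topspace[OF b] that by blast
  define D where "D = (\<lambda>((y, t), s). c ((p (K (y, t)), b y), s))"
  have "continuous_map ?YI (subtopology (prod_topology B B) N) (\<lambda>z. (p (K z), b (fst z)))"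
    using near continuous_map_compose_fun[OF pc K] continuous_map_compose_fun[OF b continuous_map_fst]
    by (auto simp: continuous_map_in_subtopology continuous_map_pairwise o_def)
  from continuous_map_compose_fun[OF this continuous_map_fst[of ?YI unit_interval]]
  have "continuous_map ?YII (prod_topology (subtopology (prod_topology B B) N) unit_interval)
      (\<lambda>z. ((p (K (fst z)), b (fst (fst z))), snd z))"
    using continuous_map_snd[of ?YI unit_interval] by (intro continuous_map_pairedI)
  from continuous_map_compose_fun[OF c this]
  have D: "continuous_map ?YII B D" by (simp add: D_def case_prod_unfold)
  \<comment> \<open>The speed of the lift vanishes at both end times and wherever \<open>m\<close>
    does. At these places \<open>K\<close> already lies over \<open>b y\<close>, so the path to be
    lifted is constant and \<open>K\<close> is left unchanged.\<close>
  define j where "j = (\<lambda>(y, t). t * (1 - t) * m y)"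
  have sc: "continuous_map ?YI euclideanreal snd"
    by (rule continuous_map_top_of_setD[OF continuous_map_snd])
  have mr: "continuous_map Y euclideanreal m" and m01: "\<And>y. y \<in> topspace Y \<Longrightarrow> m y \<in> {0..1}"
    using m by (simp_all add: continuous_map_unit_interval_iff)
  have "continuous_map ?YI euclideanreal j"
    unfolding j_def case_prod_unfold
    by (intro continuous_map_real_mult continuous_map_diff sc
        continuous_map_compose_fun[OF mr continuous_map_fst]) auto
  moreover have "j z \<in> {0..1}" if "z \<in> topspace ?YI" for z
  proof -
    obtain y t where z: "z = (y, t)" by force
    have "m y \<in> {0..1}" "t \<in> {0..1}" using that m01 by (auto simp: z)
    then show ?thesis by (auto simp: j_def z intro!: mult_le_one)
  qed
  ultimately have j: "continuous_map ?YI unit_interval j"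
    by (simp add: continuous_map_unit_interval_iff)
  have jb: "p (K (y, t)) = b y" if "y \<in> topspace Y" "t \<in> {0..1}" "j (y, t) = 0" for y t
  proof -
    have "t = 0 \<or> t = 1 \<or> m y = 0" using that(3) by (simp add: j_def)
    then consider "t = 0" | "t = 1" | "m y = 0" by blast
    then show ?thesis
    proof cases
      case 3
      show ?thesis using Km[OF that(1) 3 that(2)] ends(1)[OF that(1)] by simp
    qed (use ends that in auto)
  qed
  obtain H where H: "continuous_map ?YII E H"
    and H0: "\<And>z. z \<in> topspace ?YI \<Longrightarrow> H (z, 0) = K z"
    and pH: "\<And>z t. z \<in> topspace ?YI \<Longrightarrow> t \<in> {0..1} \<Longrightarrow> p (H (z, t)) = D (z, t)"
    and Hj: "\<And>z t. z \<in> topspace ?YI \<Longrightarrow> j z = 0 \<Longrightarrow> t \<in> {0..1} \<Longrightarrow> H (z, t) = K z"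
  proof (rule hurewicz_fibration_regular_lift[OF p K D _ j])
    show "p (K z) = D (z, 0)" if "z \<in> topspace ?YI" for z
      using that near c0 by (auto simp: D_def)
    show "D (z, s) = D (z, 0)" if "z \<in> topspace ?YI" "j z = 0" for z s
    proof -
      obtain y t where z: "z = (y, t)" by force
      have "p (K (y, t)) = b y" "b y \<in> topspace B"
        using that jb[of y t] bB[of y] by (auto simp: z)
      then show ?thesis by (simp add: D_def z cd)
    qed
  qed (use that in blast)
  show thesis
  proof (rule that[of "\<lambda>z. H (z, 1)"])
    show "continuous_map ?YI E (\<lambda>z. H (z, 1))"
      by (rule continuous_map_compose_fun[OF H]) (simp add: continuous_map_pairwise o_def)
    fix y assume y: "y \<in> topspace Y"
    have "j (y, 0) = 0" "j (y, 1) = 0" by (simp_all add: j_def)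
    then show "H ((y, 0), 1) = K (y, 0)" "H ((y, 1), 1) = K (y, 1)"
      using Hj[of "(y, 0)" 1] Hj[of "(y, 1)" 1] y by simp_all
    fix t :: real assume t: "t \<in> {0..1}"
    show "p (H ((y, t), 1)) = b y"
      using pH[of "(y, t)" 1] near[OF y t] c1 y t by (simp add: D_def)
    assume my: "m y = 0"
    then have "j (y, t) = 0" by (simp add: j_def)
    then show "H ((y, t), 1) = K (y, 0)"
      using Hj[of "(y, t)" 1] Km[OF y my t] y t by simp
  qed
qed

lemma metrizable_space_fib_prod:
  assumes "metrizable_space E"
  shows "metrizable_space (fib_prod E p)"
  unfolding fib_prod_def using assms
  by (simp add: metrizable_space_subtopology metrizable_space_prod_topology)

text \<open>The motion that approximates \<open>h\<close> on an open set leaves the fibres of \<open>p\<close>, but stays so close to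
  them that it can be pushed back.\<close>

lemma fibre_motion_extend_open:
  fixes E :: "'e topology" and B :: "'b topology"
  assumes p: "hurewicz_fibration E B p"
    and E: "metrizable_ANR E" "separable_space E" and B: "metrizable_ANR B"
    and h: "fibre_motion E p V h"
  obtains W K where "openin (fib_prod E p) W" "V \<subseteq> W" "fibre_motion E p W K"
proof -
  let ?X = "fib_prod E p"
  obtain Z O' and \<kappa> :: "'e \<Rightarrow> 'e discrete \<Rightarrow>\<^sub>C real" and r
    where Z: "convex Z" and oO: "openin (top_of_set Z) O'"
      and \<kappa>: "continuous_map E (top_of_set O') \<kappa>" and r: "continuous_map (top_of_set O') E r"
      and r\<kappa>: "\<And>x. x \<in> topspace E \<Longrightarrow> r (\<kappa> x) = x"
    by (rule metrizable_ANR_convex_chart[OF E(1)]) (rule that)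
  obtain N c where N: "openin (prod_topology B B) N" "Id_on (topspace B) \<subseteq> N"
    and c: "continuous_map (prod_topology (subtopology (prod_topology B B) N) unit_interval) B c"
    and c0: "\<And>x y. (x, y) \<in> N \<Longrightarrow> c ((x, y), 0) = x"
    and c1: "\<And>x y. (x, y) \<in> N \<Longrightarrow> c ((x, y), 1) = y"
    and cd: "\<And>x t. x \<in> topspace B \<Longrightarrow> c ((x, x), t) = x"
    by (rule metrizable_ANR_locally_equiconnected[OF B]) (rule that)
  have pc: "continuous_map E B p" using p by (simp add: hurewicz_fibration_def)
  have pB: "p x \<in> topspace B" if "x \<in> topspace E" for x
    using continuous_map_image_subset_topspace[OF pc] that by blast
  have OZ: "O' \<subseteq> Z" using openin_subset[OF oO] by simp
  have \<kappa>Z: "continuous_map E (top_of_set Z) \<kappa>"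
    using \<kappa> OZ by (auto simp: continuous_map_in_subtopology)
  have \<kappa>O: "\<kappa> x \<in> O'" if "x \<in> topspace E" for x
    using \<kappa> that by (auto simp: continuous_map_in_subtopology)
  have V: "V \<subseteq> topspace ?X"
    and hc: "continuous_map (prod_topology (subtopology ?X V) unit_interval) E h"
    and h0: "\<And>v. v \<in> V \<Longrightarrow> h (v, 0) = fst v" and h1: "\<And>v. v \<in> V \<Longrightarrow> h (v, 1) = snd v"
    and ph: "\<And>v t. v \<in> V \<Longrightarrow> t \<in> {0..1} \<Longrightarrow> p (h (v, t)) = p (fst v)"
    using h unfolding fibre_motion_def by blast+
  have hE: "h (v, t) \<in> topspace E" if "v \<in> V" "t \<in> {0..1}" for v t
  proof -
    have "(v, t) \<in> topspace (prod_topology (subtopology ?X V) unit_interval)" using that V by auto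
    then show ?thesis using continuous_map_image_subset_topspace[OF hc] by blast
  qed
  define g where "g z = (p (r (snd z)), p (fst (fst z)))"
    for z :: "('e \<times> 'e) \<times> ('e discrete \<Rightarrow>\<^sub>C real)"
  let ?P = "prod_topology ?X (top_of_set O')"
  have "continuous_map ?P (prod_topology B B) g"
    unfolding g_def
    by (intro continuous_map_pairedI continuous_map_compose_fun[OF pc]
        continuous_map_compose_fun[OF r continuous_map_snd]
        continuous_map_compose_fun[OF continuous_map_fib_prod_fst continuous_map_fst])
  \<comment> \<open>The pairs \<open>(v, z)\<close> for which \<open>r z\<close> lies over a point
    joined to the base point of \<open>v\<close> by a short path in \<open>B\<close>. This is the
    condition that the averaged paths must keep in order to be correctable.\<close>
  define G where "G = {z \<in> topspace ?P. g z \<in> N}"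
  have "openin ?P G"
    unfolding G_def by (rule openin_continuous_map_preimage) fact+
  moreover have "?P = subtopology (prod_topology ?X (top_of_set Z)) (topspace ?X \<times> O')"
  proof -
    have "top_of_set O' = subtopology (top_of_set Z) O'"
      using OZ by (simp add: subtopology_subtopology Int_absorb1)
    then show ?thesis by (simp only: prod_topology_subtopology)
  qed
  moreover have "openin (prod_topology ?X (top_of_set Z)) (topspace ?X \<times> O')"
    using oO by (simp add: openin_prod_Times_iff)
  ultimately have G: "openin (prod_topology ?X (top_of_set Z)) G"
    using openin_trans_full by metis
  have m: "metrizable_space ?X"
    using E(1) by (simp add: metrizable_space_fib_prod metrizable_ANR_def)
  have sc: "second_countable ?X"
    unfolding fib_prod_def using E
    by (intro second_countable_subtopology second_countable_prod_topology
        metrizable_separable_imp_second_countable) (auto simp: metrizable_ANR_def)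
  obtain W K where W: "openin ?X W" "V \<subseteq> W"
    and K: "continuous_map (prod_topology (subtopology ?X W) unit_interval) (top_of_set Z) K"
    and K0: "\<And>v. v \<in> W \<Longrightarrow> K (v, 0) = \<kappa> (fst v)" and K1: "\<And>v. v \<in> W \<Longrightarrow> K (v, 1) = \<kappa> (snd v)"
    and KG: "\<And>v t. v \<in> W \<Longrightarrow> t \<in> {0..1} \<Longrightarrow> (v, K (v, t)) \<in> G"
  proof (rule homotopy_approximation_open[OF m sc V Z, where h = "\<lambda>z. \<kappa> (h z)" and G = G
        and ?e1.0 = "\<lambda>v. \<kappa> (fst v)" and ?e2.0 = "\<lambda>v. \<kappa> (snd v)"])
    show "continuous_map (prod_topology (subtopology ?X V) unit_interval) (top_of_set Z) (\<lambda>z. \<kappa> (h z))"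
      by (rule continuous_map_compose_fun[OF \<kappa>Z hc])
    show "continuous_map ?X (top_of_set Z) (\<lambda>v. \<kappa> (fst v))" "continuous_map ?X (top_of_set Z) (\<lambda>v. \<kappa> (snd v))"
      by (rule continuous_map_compose_fun[OF \<kappa>Z continuous_map_fib_prod_fst]
          continuous_map_compose_fun[OF \<kappa>Z continuous_map_fib_prod_snd])+
    show "(a, \<kappa> (h (a, t))) \<in> G" if a: "a \<in> V" and t: "t \<in> {0..1}" for a t
    proof -
      have "p (fst a) \<in> topspace B" using a V pB by (auto simp: topspace_fib_prod)
      then have "(p (fst a), p (fst a)) \<in> N" using N(2) by blast
      then show ?thesis
        using a V \<kappa>O[OF hE[OF a t]] ph[OF a t] r\<kappa>[OF hE[OF a t]] by (auto simp: G_def g_def)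
    qed
  qed (use h0 h1 G in \<open>auto intro: that\<close>)
  have tW: "topspace (subtopology ?X W) = W" using openin_subset[OF W(1)] by auto
  have WE: "fst v \<in> topspace E" "snd v \<in> topspace E" "p (snd v) = p (fst v)" if "v \<in> W" for v
    using that openin_subset[OF W(1)] by (auto simp: topspace_fib_prod)
  have KO: "K (v, t) \<in> O'" and KN: "(p (r (K (v, t))), p (fst v)) \<in> N"
    if "v \<in> W" "t \<in> {0..1}" for v t
    using KG[OF that] by (auto simp: G_def g_def)
  let ?WI = "prod_topology (subtopology ?X W) unit_interval"
  have K': "continuous_map ?WI (top_of_set O') K"
    using K KO tW by (auto simp: continuous_map_in_subtopology)
  have bc: "continuous_map (subtopology ?X W) B (\<lambda>v. p (fst v))"
    by (intro continuous_map_from_subtopology continuous_map_compose_fun[OF pc continuous_map_fib_prod_fst])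
  obtain L where L: "continuous_map ?WI E L"
    and L0: "\<And>y. y \<in> W \<Longrightarrow> L (y, 0) = r (K (y, 0))"
    and L1: "\<And>y. y \<in> W \<Longrightarrow> L (y, 1) = r (K (y, 1))"
    and pL: "\<And>y t. y \<in> W \<Longrightarrow> t \<in> {0..1} \<Longrightarrow> p (L (y, t)) = p (fst y)"
  \<comment> \<open>With \<open>m = 1\<close> the correction preserves the end points and is
    otherwise free to move the paths.\<close>
  proof (rule fibre_homotopy_correction[OF p c c0 c1 cd continuous_map_compose_fun[OF r K'] bc,
        where m = "\<lambda>_. 1", unfolded tW])
    show "continuous_map (subtopology ?X W) unit_interval (\<lambda>_. 1)" by simp
  qed (use that KN K0 K1 r\<kappa> WE in auto)
  have "fibre_motion E p W L"
    unfolding fibre_motion_def using L L0 L1 pL K0 K1 r\<kappa> WE openin_subset[OF W(1)] by auto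
  then show thesis using that W by blast
qed

text \<open>A short path in \<open>E\<close> between two points of a fibre need not stay in that
  fibre, but close to the diagonal it stays over a small set, from which it can be pushed back. The
  correction is switched off on the diagonal, where the path is constant already.\<close>

lemma fibre_motion_near_diagonal:
  fixes E :: "'e topology" and B :: "'b topology"
  assumes p: "hurewicz_fibration E B p" and E: "metrizable_ANR E" and B: "metrizable_ANR B"
  obtains W K where "openin (fib_prod E p) W" "Id_on (topspace E) \<subseteq> W" "fibre_motion E p W K"
    "\<And>e t. e \<in> topspace E \<Longrightarrow> t \<in> {0..1} \<Longrightarrow> K ((e, e), t) = e"
proof -
  let ?X = "fib_prod E p"
  obtain Z O' and \<kappa> :: "'e \<Rightarrow> 'e discrete \<Rightarrow>\<^sub>C real" and r
    where \<kappa>: "continuous_map E (top_of_set O') \<kappa>" and r\<kappa>: "\<And>x. x \<in> topspace E \<Longrightarrow> r (\<kappa> x) = x"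
    by (rule metrizable_ANR_convex_chart[OF E]) (rule that)
  obtain N c where N: "openin (prod_topology B B) N" "Id_on (topspace B) \<subseteq> N"
    and c: "continuous_map (prod_topology (subtopology (prod_topology B B) N) unit_interval) B c"
    and c0: "\<And>x y. (x, y) \<in> N \<Longrightarrow> c ((x, y), 0) = x"
    and c1: "\<And>x y. (x, y) \<in> N \<Longrightarrow> c ((x, y), 1) = y"
    and cd: "\<And>x t. x \<in> topspace B \<Longrightarrow> c ((x, x), t) = x"
    by (rule metrizable_ANR_locally_equiconnected[OF B]) (rule that)
  obtain M k where M: "openin (prod_topology E E) M" "Id_on (topspace E) \<subseteq> M"
    and k: "continuous_map (prod_topology (subtopology (prod_topology E E) M) unit_interval) E k"
    and k0: "\<And>x y. (x, y) \<in> M \<Longrightarrow> k ((x, y), 0) = x"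
    and k1: "\<And>x y. (x, y) \<in> M \<Longrightarrow> k ((x, y), 1) = y"
    and kd: "\<And>x t. x \<in> topspace E \<Longrightarrow> k ((x, x), t) = x"
    by (rule metrizable_ANR_locally_equiconnected[OF E]) (rule that)
  have pc: "continuous_map E B p" using p by (simp add: hurewicz_fibration_def)
  have pB: "p x \<in> topspace B" if "x \<in> topspace E" for x
    using continuous_map_image_subset_topspace[OF pc] that by blast
  define M' where "M' = {(x, y). p x = p y} \<inter> M"
  have oM': "openin ?X M'"
    unfolding M'_def fib_prod_def by (rule openin_subtopology_Int2[OF M(1)])
  have tM': "topspace (subtopology ?X M') = M'" using openin_subset[OF oM'] by auto
  let ?MI = "prod_topology (subtopology ?X M') unit_interval"
  have idM: "continuous_map (subtopology ?X M') (subtopology (prod_topology E E) M) (\<lambda>x. x)"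
    by (auto simp: continuous_map_in_subtopology M'_def fib_prod_def
        intro!: continuous_map_from_subtopology)
  have kM: "continuous_map ?MI E k"
    using continuous_map_compose_fun[OF k continuous_map_pairedI[OF continuous_map_compose_fun[OF idM
          continuous_map_fst] continuous_map_snd]] by simp
  define g where "g z = (p (k z), p (fst (fst z)))" for z :: "('e \<times> 'e) \<times> real"
  have "continuous_map ?MI (prod_topology B B) g"
    unfolding g_def
    by (intro continuous_map_pairedI continuous_map_compose_fun[OF pc] kM
        continuous_map_compose_fun[OF continuous_map_from_subtopology[OF continuous_map_fib_prod_fst] continuous_map_fst])
  define W where "W = {v \<in> topspace (subtopology ?X M'). \<forall>t\<in>{0..1}. (v, t) \<in> {z \<in> topspace ?MI. g z \<in> N}}"
  have "openin (subtopology ?X M') W"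
    unfolding W_def
    by (rule openin_forall_unit_interval[OF openin_continuous_map_preimage]) fact+
  then have W: "openin ?X W" using oM' by (rule openin_trans_full)
  have WM: "W \<subseteq> M'" unfolding W_def tM' by blast
  have WN: "(p (k (v, t)), p (fst v)) \<in> N" if "v \<in> W" "t \<in> {0..1}" for v t
    using that by (auto simp: W_def g_def)
  have \<Delta>: "Id_on (topspace E) \<subseteq> W"
  proof
    fix v assume "v \<in> Id_on (topspace E)"
    then obtain e where v: "v = (e, e)" "e \<in> topspace E" by auto
    have "(e, e) \<in> M'" using M(2) v by (auto simp: M'_def)
    moreover have "(p e, p e) \<in> N" using N(2) pB[OF v(2)] by blast
    ultimately show "v \<in> W" using openin_subset[OF oM'] by (auto simp: W_def g_def kd v)
  qed
  have WE: "fst v \<in> topspace E" "snd v \<in> topspace E" "p (snd v) = p (fst v)" "(fst v, snd v) \<in> M" if "v \<in> W" for v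
  proof -
    have "v \<in> M'" using that WM by blast
    then have "v \<in> topspace ?X" "v \<in> M" using openin_subset[OF oM'] by (auto simp: M'_def)
    then show "fst v \<in> topspace E" "snd v \<in> topspace E" "p (snd v) = p (fst v)" "(fst v, snd v) \<in> M"
      by (auto simp: topspace_fib_prod)
  qed
  have tW: "topspace (subtopology ?X W) = W" using openin_subset[OF W(1)] by auto
  let ?WI = "prod_topology (subtopology ?X W) unit_interval"
  have "?WI = subtopology ?MI (W \<times> UNIV)"
    using WM by (simp add: prod_topology_subtopology_fst[symmetric] subtopology_subtopology Int_absorb1)
  then have kW: "continuous_map ?WI E k" using kM by (simp add: continuous_map_from_subtopology)
  have bc: "continuous_map (subtopology ?X W) B (\<lambda>v. p (fst v))"
    by (intro continuous_map_from_subtopology continuous_map_compose_fun[OF pc continuous_map_fib_prod_fst])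
  \<comment> \<open>Capped distance of the embedded points. As \<open>r\<close> inverts
    \<open>\<kappa>\<close>, it vanishes exactly on the diagonal.\<close>
  define m where "m v = min 1 (norm (\<kappa> (fst v) - \<kappa> (snd v)))" for v
  have \<kappa>e: "continuous_map E euclidean \<kappa>" using \<kappa> by (rule continuous_map_top_of_setD)
  have mc: "continuous_map (subtopology ?X W) unit_interval m"
    unfolding continuous_map_unit_interval_iff m_def
    by (auto intro!: continuous_map_real_min continuous_map_norm continuous_map_diff
        continuous_map_from_subtopology continuous_map_compose_fun[OF \<kappa>e]
        continuous_map_fib_prod_fst continuous_map_fib_prod_snd)
  have m0: "fst v = snd v" if "v \<in> W" "m v = 0" for v
  proof -
    have "\<kappa> (fst v) = \<kappa> (snd v)" using that(2) by (auto simp: m_def min_def split: if_splits)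
    then show ?thesis using r\<kappa> WE[OF that(1)] by metis
  qed
  obtain L where L: "continuous_map ?WI E L"
    and L0: "\<And>y. y \<in> W \<Longrightarrow> L (y, 0) = k (y, 0)"
    and L1: "\<And>y. y \<in> W \<Longrightarrow> L (y, 1) = k (y, 1)"
    and pL: "\<And>y t. y \<in> W \<Longrightarrow> t \<in> {0..1} \<Longrightarrow> p (L (y, t)) = p (fst y)"
    and Lm: "\<And>y t. y \<in> W \<Longrightarrow> m y = 0 \<Longrightarrow> t \<in> {0..1} \<Longrightarrow> L (y, t) = k (y, 0)"
  proof (rule fibre_homotopy_correction[OF p c c0 c1 cd kW bc, where m = m, unfolded tW])
    show "k (y, t) = k (y, 0)" if "y \<in> W" "m y = 0" for y t
      using m0[OF that] WE(1)[OF that(1)] kd[of "fst y"] by (metis prod.collapse)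
    show "p (k (y, 0)) = p (fst y)" "p (k (y, 1)) = p (fst y)" if "y \<in> W" for y
      using WE[OF that] k0[of "fst y" "snd y"] k1[of "fst y" "snd y"] by simp_all
  qed (use that WN mc in auto)
  have "fibre_motion E p W L"
    unfolding fibre_motion_def
  proof (intro conjI ballI)
    fix v assume v: "v \<in> W"
    show "L (v, 0) = fst v" "L (v, 1) = snd v"
      using WE[OF v] k0[of "fst v" "snd v"] k1[of "fst v" "snd v"] L0[OF v] L1[OF v] by simp_all
  qed (use L pL openin_subset[OF W] in auto)
  moreover have "L ((e, e), t) = e" if e: "e \<in> topspace E" and t: "t \<in> {0..1}" for e t
    using Lm[of "(e, e)" t] \<Delta> e t kd[OF e] by (auto simp: m_def)
  ultimately show thesis using that W \<Delta> by blast
qed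

section \<open>Motions that are constant on the diagonal\<close>

lemma fibre_motionD:
  assumes "fibre_motion E p V h"
  shows "V \<subseteq> topspace (fib_prod E p)"
    and "continuous_map (prod_topology (subtopology (fib_prod E p) V) unit_interval) E h"
    and "\<And>v. v \<in> V \<Longrightarrow> h (v, 0) = fst v" "\<And>v. v \<in> V \<Longrightarrow> h (v, 1) = snd v"
    and "\<And>v t. v \<in> V \<Longrightarrow> t \<in> {0..1} \<Longrightarrow> p (h (v, t)) = p (fst v)"
    and "\<And>v t. v \<in> V \<Longrightarrow> t \<in> {0..1} \<Longrightarrow> h (v, t) \<in> topspace E"
proof -
  show V: "V \<subseteq> topspace (fib_prod E p)"
    and c: "continuous_map (prod_topology (subtopology (fib_prod E p) V) unit_interval) E h"
    using assms unfolding fibre_motion_def by blast+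
  show "\<And>v. v \<in> V \<Longrightarrow> h (v, 0) = fst v" "\<And>v. v \<in> V \<Longrightarrow> h (v, 1) = snd v"
    "\<And>v t. v \<in> V \<Longrightarrow> t \<in> {0..1} \<Longrightarrow> p (h (v, t)) = p (fst v)"
    using assms unfolding fibre_motion_def by blast+
  fix v and t :: real assume "v \<in> V" "t \<in> {0..1}"
  then have "(v, t) \<in> topspace (prod_topology (subtopology (fib_prod E p) V) unit_interval)"
    using V by auto
  then show "h (v, t) \<in> topspace E" using continuous_map_image_subset_topspace[OF c] by blast
qed

lemma fibre_motion_subset:
  assumes "fibre_motion E p V h" "W \<subseteq> V"
  shows "fibre_motion E p W h"
proof -
  note h = fibre_motionD[OF assms(1)]
  have "prod_topology (subtopology (fib_prod E p) W) unit_interval =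
      subtopology (prod_topology (subtopology (fib_prod E p) V) unit_interval) (W \<times> UNIV)"
    using assms(2)
    by (simp add: prod_topology_subtopology_fst[symmetric] subtopology_subtopology Int_absorb1)
  then show ?thesis
    using h assms(2) unfolding fibre_motion_def
    by (auto simp: continuous_map_from_subtopology)
qed

lemma fibre_motion_disjoint_union:
  assumes A: "openin (fib_prod E p) A" "fibre_motion E p A f"
    and B: "openin (fib_prod E p) B" "fibre_motion E p B g" and AB: "A \<inter> B = {}"
  shows "fibre_motion E p (A \<union> B) (\<lambda>(v, t). if v \<in> A then f (v, t) else g (v, t))"
proof -
  let ?h = "\<lambda>(v, t). if v \<in> A then f (v, t) else g (v, t)"
  let ?P = "prod_topology (subtopology (fib_prod E p) (A \<union> B)) unit_interval"
  note f = fibre_motionD[OF A(2)] and g = fibre_motionD[OF B(2)]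
  have sub: "subtopology ?P (S \<times> {0..1}) = prod_topology (subtopology (fib_prod E p) S) unit_interval"
    if "S \<subseteq> A \<union> B" for S
    using that prod_topology_subtopology(1)[of "subtopology (fib_prod E p) (A \<union> B)" S unit_interval]
    by (simp only: topspace_euclidean_subtopology subtopology_subtopology Int_absorb1)
  have op: "openin ?P (S \<times> {0..1})" if "S \<subseteq> A \<union> B" "openin (fib_prod E p) S" for S
    using openin_subtopology_Int2[OF that(2), of "A \<union> B"] that(1)
    by (simp add: openin_prod_Times_iff Int_absorb1)
  have "continuous_map ?P E ?h"
  proof (rule continuous_map_locally)
    fix x assume x: "x \<in> topspace ?P"
    show "\<exists>U. openin ?P U \<and> x \<in> U \<and> continuous_map (subtopology ?P U) E ?h"
    proof (cases "fst x \<in> A")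
      case True
      have "continuous_map (subtopology ?P (A \<times> {0..1})) E ?h"
        unfolding sub[OF Un_upper1] by (rule continuous_map_eq[OF f(2)]) auto
      then show ?thesis using op[OF Un_upper1 A(1)] True x by (intro exI[of _ "A \<times> {0..1}"]) auto
    next
      case False
      have "continuous_map (subtopology ?P (B \<times> {0..1})) E ?h"
        unfolding sub[OF Un_upper2] by (rule continuous_map_eq[OF g(2)]) (use AB in auto)
      then show ?thesis using op[OF Un_upper2 B(1)] False x by (intro exI[of _ "B \<times> {0..1}"]) auto
    qed
  qed
  then show ?thesis unfolding fibre_motion_def using f g by auto
qed

text \<open>The \<open>min\<close> and \<open>max\<close> keep the parameters of both branches in
  the unit interval at all times, so each branch is continuous on the whole product before the two
  are pasted at time 1/2.\<close>

lemma continuous_map_path_join: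
  assumes f: "continuous_map (prod_topology Y unit_interval) E f"
    and g: "continuous_map (prod_topology Y unit_interval) E g"
    and fg: "\<And>y. y \<in> topspace Y \<Longrightarrow> f (y, 1) = g (y, 0)"
  shows "continuous_map (prod_topology Y unit_interval) E
    (\<lambda>z. if snd z \<le> 1/2 then f (fst z, min 1 (2 * snd z)) else g (fst z, max 0 (2 * snd z - 1)))"
proof -
  let ?P = "prod_topology Y unit_interval"
  have sc: "continuous_map ?P euclideanreal snd"
    by (rule continuous_map_top_of_setD[OF continuous_map_snd])
  have "continuous_map ?P unit_interval (\<lambda>z. min 1 (2 * snd z))"
    "continuous_map ?P unit_interval (\<lambda>z. max 0 (2 * snd z - 1))"
    unfolding continuous_map_unit_interval_iff
    by (auto intro!: continuous_map_real_min continuous_map_real_max continuous_map_diff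
        continuous_map_real_mult sc)
  then have "continuous_map ?P E (\<lambda>z. f (fst z, min 1 (2 * snd z)))"
    "continuous_map ?P E (\<lambda>z. g (fst z, max 0 (2 * snd z - 1)))"
    by (auto intro!: continuous_map_compose_fun[OF f] continuous_map_compose_fun[OF g]
        continuous_map_pairedI continuous_map_fst)
  then show ?thesis
    using sc fg by (intro continuous_map_cases_le continuous_map_from_subtopology) auto
qed

lemma closedin_fib_prod_diagonal:
  assumes "Hausdorff_space E"
  shows "closedin (fib_prod E p) (Id_on (topspace E))"
proof -
  have "closedin (prod_topology E E) (Id_on (topspace E))"
    using assms unfolding Hausdorff_space_closedin_diagonal Id_on_def by (simp add: UNION_singleton_eq_range)
  moreover have "Id_on (topspace E) = Id_on (topspace E) \<inter> {(x, y). p x = p y}" by auto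
  ultimately show ?thesis unfolding fib_prod_def closedin_subtopology by blast
qed

text \<open>The path from \<open>x\<close> to \<open>y\<close> first runs back along the loop \<open>h (x, x)\<close> from time \<open>1\<close> to
  time \<open>1 - u\<close>, then hops by \<open>k\<close> to the path \<open>h (x, y)\<close> and follows it from time \<open>1 - u\<close> on. Here
  \<open>u\<close> vanishes on the diagonal and equals \<open>1\<close>, where the hop is trivial, as soon as \<open>h (x, x)\<close> and
  \<open>h (x, y)\<close> are too far apart for \<open>k\<close> to be defined.\<close>

lemma fibre_motion_normalize_diagonal:
  assumes E: "metrizable_space E"
    and W: "openin (fib_prod E p) W" "Id_on (topspace E) \<subseteq> W" "fibre_motion E p W h"
    and N: "openin (fib_prod E p) N" "Id_on (topspace E) \<subseteq> N" "fibre_motion E p N k"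
    and k: "\<And>e t. e \<in> topspace E \<Longrightarrow> t \<in> {0..1} \<Longrightarrow> k ((e, e), t) = e"
  obtains h' where "fibre_motion E p W h'"
    "\<And>e t. e \<in> topspace E \<Longrightarrow> t \<in> {0..1} \<Longrightarrow> h' ((e, e), t) = e"
proof -
  let ?X = "fib_prod E p"
  let ?XW = "subtopology ?X W"
  let ?P = "prod_topology ?XW unit_interval"
  note h = fibre_motionD[OF W(3)] and k' = fibre_motionD[OF N(3)]
  have tW: "topspace ?XW = W" using h(1) by auto
  have WE: "fst v \<in> topspace E" "snd v \<in> topspace E" "p (snd v) = p (fst v)" "(fst v, fst v) \<in> W"
    if "v \<in> W" for v
  proof -
    have "v \<in> topspace ?X" using that h(1) by blast
    then show v: "fst v \<in> topspace E" "snd v \<in> topspace E" "p (snd v) = p (fst v)"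
      by (auto simp: topspace_fib_prod)
    show "(fst v, fst v) \<in> W" using W(2) Id_onI[OF v(1)] by blast
  qed
  have sc: "continuous_map ?P euclideanreal snd"
    by (rule continuous_map_top_of_setD[OF continuous_map_snd])
  have fstW: "continuous_map ?XW E fst"
    by (rule continuous_map_from_subtopology[OF continuous_map_fib_prod_fst])
  have diagX: "continuous_map ?XW ?X (\<lambda>v. (fst v, fst v))"
    by (rule continuous_map_into_fib_prod) (simp_all add: fstW)
  have diag: "continuous_map ?XW ?XW (\<lambda>v. (fst v, fst v))"
    unfolding continuous_map_in_subtopology[of ?XW ?X W "\<lambda>v. (fst v, fst v)"]
    using diagX WE(4) tW by auto
  \<comment> \<open>Pairs the loop at \<open>x\<close> with the path from \<open>x\<close> to
    \<open>y\<close>, at equal times. Both run in the fibre over \<open>p x\<close>, so the pair is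
    a point of the fibre product to which \<open>k\<close> may apply.\<close>
  define q where "q z = (h ((fst (fst z), fst (fst z)), snd z), h z)" for z
  have qc: "continuous_map ?P ?X q"
    unfolding q_def
  proof (rule continuous_map_into_fib_prod)
    show "continuous_map ?P E (\<lambda>z. h ((fst (fst z), fst (fst z)), snd z))"
      by (intro continuous_map_compose_fun[OF h(2)] continuous_map_pairedI
          continuous_map_compose_fun[OF diag] continuous_map_fst continuous_map_snd)
    show "p (h ((fst (fst z), fst (fst z)), snd z)) = p (h z)" if "z \<in> topspace ?P" for z
    proof -
      have z: "fst z \<in> W" "snd z \<in> {0..1}" using that tW by (auto simp: mem_Times_iff)
      show ?thesis using h(5)[OF WE(4)[OF z(1)] z(2)] h(5)[OF z] by simp
    qed
  qed (rule h(2))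
  define N0 where "N0 = {v \<in> topspace ?XW. \<forall>t\<in>{0..1}. (v, t) \<in> {z \<in> topspace ?P. q z \<in> N}}"
  have "openin ?XW N0"
    unfolding N0_def
    by (rule openin_forall_unit_interval[OF openin_continuous_map_preimage[OF qc N(1)]])
  then have N0: "openin ?X N0" using W(1) by (rule openin_trans_full)
  have qN0: "q (v, t) \<in> N" if "v \<in> N0" "t \<in> {0..1}" for v t
    using that by (auto simp: N0_def)
  have "Id_on (topspace E) \<subseteq> N0"
  proof
    fix v assume "v \<in> Id_on (topspace E)"
    then obtain e where v: "v = (e, e)" "e \<in> topspace E" by auto
    have vW: "v \<in> W" using W(2) v by blast
    then have "q (v, t) \<in> N" if "t \<in> {0..1}" for t
      using N(2) h(6)[OF vW that] by (auto simp: q_def v)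
    then show "v \<in> N0" using vW tW by (auto simp: N0_def)
  qed
  then have "disjnt (Id_on (topspace E)) (topspace ?X - N0)" by (auto simp: disjnt_def)
  moreover have "closedin ?X (Id_on (topspace E))"
    using E by (simp add: closedin_fib_prod_diagonal metrizable_imp_Hausdorff_space)
  moreover have "closedin ?X (topspace ?X - N0)" using N0 by blast
  moreover have "normal_space ?X"
    using E by (simp add: metrizable_imp_normal_space metrizable_space_fib_prod)
  ultimately obtain u where u: "continuous_map ?X unit_interval u"
    and u0: "u ` Id_on (topspace E) \<subseteq> {0}" and u1: "u ` (topspace ?X - N0) \<subseteq> {1}"
    by (metis Urysohn_lemma zero_le_one)
  have ur: "continuous_map ?X euclideanreal u" and u01: "\<And>v. v \<in> topspace ?X \<Longrightarrow> u v \<in> {0..1}"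
    using u by (simp_all add: continuous_map_unit_interval_iff)
  have uW: "u v \<in> {0..1}" if "v \<in> W" for v using u01 h(1) that by blast
  have uP: "continuous_map ?P euclideanreal (\<lambda>z. u (fst z))"
    by (rule continuous_map_compose_fun[OF continuous_map_from_subtopology[OF ur] continuous_map_fst])
  have fwd: "continuous_map ?P unit_interval (\<lambda>z. 1 - snd z * u (fst z))"
    and bwd: "continuous_map ?P unit_interval (\<lambda>z. 1 - (1 - snd z) * u (fst z))"
    unfolding continuous_map_unit_interval_iff using uW tW
    by (auto intro!: continuous_map_real_mult continuous_map_diff sc uP mult_le_one)
  define P1 where "P1 z = h ((fst (fst z), fst (fst z)), 1 - snd z * u (fst z))" for z
  \<comment> \<open>The place of the hop. Outside \<open>N0\<close> the time \<open>1 - u v\<close>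
    is 0, when both paths are at \<open>x\<close>; hence \<open>w v\<close> lies in \<open>N\<close>
    there too.\<close>
  define w where "w v = q (v, 1 - u v)" for v
  define P2 where "P2 z = k (w (fst z), snd z)" for z :: "('a \<times> 'a) \<times> real"
  define P3 where "P3 z = h (fst z, 1 - (1 - snd z) * u (fst z))" for z
  have P1: "continuous_map ?P E P1"
    unfolding P1_def
    by (intro continuous_map_compose_fun[OF h(2)] continuous_map_pairedI
        continuous_map_compose_fun[OF diag continuous_map_fst] fwd)
  have P3: "continuous_map ?P E P3"
    unfolding P3_def
    by (intro continuous_map_compose_fun[OF h(2)] continuous_map_pairedI continuous_map_fst bwd)
  have wN: "w v \<in> N" if v: "v \<in> W" for v
  proof (cases "v \<in> N0")
    case True
    then show ?thesis using qN0[OF True, of "1 - u v"] uW[OF v] by (simp add: w_def)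
  next
    case False
    then have "u v = 1" using u1 h(1) v by blast
    then show ?thesis
      using h(3)[OF v] h(3)[OF WE(4)[OF v]] N(2) WE(1)[OF v] by (auto simp: w_def q_def)
  qed
  have "continuous_map ?XW unit_interval (\<lambda>v. 1 - u v)"
    unfolding continuous_map_unit_interval_iff using uW tW
    by (auto intro!: continuous_map_diff continuous_map_from_subtopology ur)
  then have "continuous_map ?XW ?X w"
    unfolding w_def by (intro continuous_map_compose_fun[OF qc] continuous_map_pairedI) auto
  then have "continuous_map ?XW (subtopology ?X N) w"
    using wN tW by (auto simp: continuous_map_in_subtopology)
  then have P2: "continuous_map ?P E P2"
    unfolding P2_def
    by (intro continuous_map_compose_fun[OF k'(2)] continuous_map_pairedI
        continuous_map_compose_fun[OF _ continuous_map_fst] continuous_map_snd)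
  have joins: "P1 (v, 1) = P2 (v, 0)" "P2 (v, 1) = P3 (v, 0)" if "v \<in> W" for v
    using k'(3,4)[OF wN[OF that]] by (simp_all add: P1_def P2_def P3_def w_def q_def)
  define R where "R z = (if snd z \<le> 1/2 then P2 (fst z, min 1 (2 * snd z))
    else P3 (fst z, max 0 (2 * snd z - 1)))" for z
  have R: "continuous_map ?P E R"
    unfolding R_def by (rule continuous_map_path_join[OF P2 P3]) (use joins tW in auto)
  define h' where "h' z = (if snd z \<le> 1/2 then P1 (fst z, min 1 (2 * snd z))
    else R (fst z, max 0 (2 * snd z - 1)))" for z
  have h': "continuous_map ?P E h'"
    unfolding h'_def by (rule continuous_map_path_join[OF P1 R]) (use joins tW in \<open>auto simp: R_def\<close>)
  have in01: "min 1 (2 * t) \<in> {0..1}" "max 0 (2 * t - 1) \<in> {0..1}" if "t \<in> {0..1}" for t :: real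
    using that by auto
  have b01: "1 - t * u v \<in> {0..1}" "1 - (1 - t) * u v \<in> {0..1}" if "v \<in> W" "t \<in> {0..1}" for v t
    using uW[OF that(1)] that(2) by (auto intro!: mult_le_one)
  have p1: "p (P1 (v, t)) = p (fst v)" if "v \<in> W" "t \<in> {0..1}" for v t
    using h(5)[OF WE(4)[OF that(1)] b01(1)[OF that]] by (simp add: P1_def)
  have p2: "p (P2 (v, t)) = p (fst v)" if "v \<in> W" "t \<in> {0..1}" for v t
    using k'(5)[OF wN[OF that(1)] that(2)] h(5)[OF WE(4)[OF that(1)] b01(1)[OF that(1), of 1]]
    by (simp add: P2_def w_def q_def)
  have p3: "p (P3 (v, t)) = p (fst v)" if "v \<in> W" "t \<in> {0..1}" for v t
    using h(5)[OF that(1) b01(2)[OF that]] by (simp add: P3_def)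
  have pR: "p (R (v, t)) = p (fst v)" if "v \<in> W" "t \<in> {0..1}" for v t
    using p2[OF that(1) in01(1)[OF that(2)]] p3[OF that(1) in01(2)[OF that(2)]]
    by (cases "t \<le> 1/2") (simp_all only: R_def fst_conv snd_conv if_True if_False)
  have ph': "p (h' (v, t)) = p (fst v)" if "v \<in> W" "t \<in> {0..1}" for v t
    using p1[OF that(1) in01(1)[OF that(2)]] pR[OF that(1) in01(2)[OF that(2)]]
    by (cases "t \<le> 1/2") (simp_all only: h'_def fst_conv snd_conv if_True if_False)
  have "fibre_motion E p W h'"
    unfolding fibre_motion_def using h(1) h' ph' h(4) WE(4)
    by (auto simp: h'_def R_def P1_def P3_def)
  \<comment> \<open>On the diagonal \<open>u\<close> vanishes, so the outer pieces rest at the end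
    \<open>e\<close> of the loop, and the hop from \<open>e\<close> to itself is constant by the
    choice of \<open>k\<close>.\<close>
  moreover have "h' ((e, e), t) = e" if e: "e \<in> topspace E" and t: "t \<in> {0..1}" for e t
  proof -
    have eW: "(e, e) \<in> W" and eI: "(e, e) \<in> Id_on (topspace E)" using W(2) e by auto
    have ue: "u (e, e) = 0" using u0 eI by blast
    have P13: "P1 ((e, e), s) = e" "P3 ((e, e), s) = e" for s
      using h(4)[OF eW] by (simp_all add: P1_def P3_def ue)
    have "P2 ((e, e), s) = e" if "s \<in> {0..1}" for s
      using h(4)[OF eW] k[OF e that] by (simp add: P2_def w_def q_def ue)
    from this[OF in01(1)] P13 have "R ((e, e), s) = e" if "s \<in> {0..1}" for s
      using that by (cases "s \<le> 1/2") (simp_all only: R_def fst_conv snd_conv if_True if_False)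
    from this[OF in01(2)[OF t]] P13 show ?thesis
      by (cases "t \<le> 1/2") (simp_all only: h'_def fst_conv snd_conv if_True if_False)
  qed
  ultimately show thesis using that by blast
qed

text \<open>For \<open>i > 0\<close> the closure of \<open>M\<close> is cut out of
  \<open>W i\<close>, and \<open>M\<close> with the diagonal-preserving motion \<open>g\<close> is
  put back as a disjoint open piece. What is lost in this way lies in the closure of
  \<open>M\<close>, hence in \<open>W 0\<close>, so the sets still cover.\<close>

lemma TC_M_le:
  fixes E :: "'e topology" and B :: "'b topology"
  assumes p: "hurewicz_fibration E B p" and E: "metrizable_ANR E" and B: "metrizable_ANR B"
    and cov: "(\<Union>i\<le>k. W i) = topspace (fib_prod E p)"
    and W: "\<And>i. i \<le> k \<Longrightarrow> openin (fib_prod E p) (W i)"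
    and h: "\<And>i. i \<le> k \<Longrightarrow> fibre_motion E p (W i) (h i)"
    and \<Delta>: "Id_on (topspace E) \<subseteq> W 0"
  shows "TC_M E p \<le> enat k"
proof -
  let ?X = "fib_prod E p" and ?\<Delta> = "Id_on (topspace E)"
  have Em: "metrizable_space E" using E by (simp add: metrizable_ANR_def)
  obtain N g where N: "openin ?X N" "?\<Delta> \<subseteq> N" "fibre_motion E p N g"
    and g: "\<And>e t. e \<in> topspace E \<Longrightarrow> t \<in> {0..1} \<Longrightarrow> g ((e, e), t) = e"
    by (rule fibre_motion_near_diagonal[OF p E B]) (rule that)
  obtain h0 where h0: "fibre_motion E p (W 0) h0"
    "\<And>e t. e \<in> topspace E \<Longrightarrow> t \<in> {0..1} \<Longrightarrow> h0 ((e, e), t) = e"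
    by (rule fibre_motion_normalize_diagonal[OF Em W[OF le0] \<Delta> h[OF le0] N g]) (auto intro: that)
  have "normal_space ?X"
    using Em by (simp add: metrizable_imp_normal_space metrizable_space_fib_prod)
  moreover have "closedin ?X ?\<Delta>"
    using Em by (simp add: closedin_fib_prod_diagonal metrizable_imp_Hausdorff_space)
  moreover have "openin ?X (W 0 \<inter> N)" "?\<Delta> \<subseteq> W 0 \<inter> N" using W[OF le0] N \<Delta> by auto
  \<comment> \<open>Normality puts the closure of \<open>M\<close>, and not just \<open>M\<close>,
    inside \<open>W 0 \<inter> N\<close>. Removing this closure leaves an open set disjoint from
    \<open>M\<close>, so the two motions combine without any matching condition.\<close>
  ultimately obtain M where M: "openin ?X M" "?\<Delta> \<subseteq> M" "?X closure_of M \<subseteq> W 0 \<inter> N"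
    unfolding normal_space_alt by metis
  have MM: "M \<subseteq> ?X closure_of M" by (rule closure_of_subset[OF openin_subset[OF M(1)]])
  have WM: "openin ?X (W i - ?X closure_of M)" if "i \<le> k" for i
    by (rule openin_diff[OF W[OF that] closedin_closure_of])
  define V where "V i = (if i = 0 then W 0 else M \<union> (W i - ?X closure_of M))" for i
  define f where "f i = (if i = 0 then h0 else (\<lambda>(v, t). if v \<in> M then g (v, t) else h i (v, t)))" for i
  have oV: "openin ?X (V i)" if "i \<le> k" for i
    using W[OF le0] openin_Un[OF M(1) WM[OF that]] by (simp add: V_def)
  have f: "fibre_motion E p (V i) (f i)" if i: "i \<le> k" for i
  proof (cases "i = 0")
    case True
    then show ?thesis using h0 by (simp add: V_def f_def)
  next
    case False
    have "fibre_motion E p M g" by (rule fibre_motion_subset[OF N(3)]) (use MM M(3) in blast)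
    moreover have "fibre_motion E p (W i - ?X closure_of M) (h i)"
      by (rule fibre_motion_subset[OF h[OF i]]) blast
    ultimately show ?thesis
      using fibre_motion_disjoint_union[OF M(1) _ WM[OF i], of g "h i"] MM False
      by (auto simp: V_def f_def)
  qed
  have "(\<Union>i\<le>k. V i) = topspace ?X"
  proof
    show "(\<Union>i\<le>k. V i) \<subseteq> topspace ?X" using oV openin_subset by blast
    show "topspace ?X \<subseteq> (\<Union>i\<le>k. V i)"
    proof
      fix v assume "v \<in> topspace ?X"
      then obtain i where i: "i \<le> k" "v \<in> W i" using cov by blast
      show "v \<in> (\<Union>i\<le>k. V i)"
      proof (cases "i = 0 \<or> v \<in> ?X closure_of M")
        case True
        then have "v \<in> V 0" using i M(3) by (auto simp: V_def)
        then show ?thesis by blast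
      next
        case False
        then have "v \<in> V i" using i by (simp add: V_def)
        then show ?thesis using i(1) by blast
      qed
    qed
  qed
  moreover have "?\<Delta> \<subseteq> V i" for i using \<Delta> M(2) by (auto simp: V_def)
  moreover have "\<exists>s. section_over (fib_path_space E p) ?X endpoints (V i) s \<and>
      (\<forall>e\<in>topspace E. s (e, e) = const_path e)" if i: "i \<le> k" for i
  proof (intro exI conjI ballI)
    show "section_over (fib_path_space E p) ?X endpoints (V i) (\<lambda>v. \<lambda>t\<in>{0..1}. f i (v, t))"
      by (rule fibre_motion_imp_section_over[OF f[OF i]])
    fix e assume e: "e \<in> topspace E"
    then have "f i ((e, e), t) = e" if "t \<in> {0..1}" for t
      using that h0(2) g M(2) by (auto simp: f_def Id_on_def)
    then show "(\<lambda>t\<in>{0..1}. f i ((e, e), t)) = const_path e"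
      unfolding const_path_def by (intro restrict_ext) auto
  qed
  ultimately have "enat k \<in> {enat n | n. \<exists>V. (\<Union>i\<le>n. V i) = topspace ?X \<and>
     (\<forall>i\<le>n. openin ?X (V i) \<and> ?\<Delta> \<subseteq> V i \<and>
        (\<exists>s. section_over (fib_path_space E p) ?X endpoints (V i) s \<and>
             (\<forall>e\<in>topspace E. s (e, e) = const_path e)))}"
    using oV by (intro CollectI exI[of _ k] exI[of _ V] conjI refl) simp_all
  then show ?thesis unfolding TC_M_def by (rule Inf_lower)
qed

section \<open>Comparison of the three complexities\<close>

lemma TC_le_TC_M: "TC E p \<le> TC_M E p"
  unfolding TC_def TC_M_def secat_def
proof (rule Inf_superset_mono, rule Collect_mono, intro impI, elim exE conjE, intro exI conjI)
qed (assumption | blast)+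

text \<open>Each set of an arbitrary cover grows to an open set that still carries a motion, so
  dropping openness does not lower the number of sets.\<close>

lemma TC_eq_TC_g:
  assumes p: "hurewicz_fibration E B p"
    and E: "metrizable_ANR E" "separable_space E" and B: "metrizable_ANR B"
  shows "TC E p = TC_g E p"
proof (rule antisym)
  show "TC_g E p \<le> TC E p"
    unfolding TC_def TC_g_def secat_def secat_g_def
  proof (rule Inf_superset_mono, rule Collect_mono, intro impI, elim exE conjE, intro exI conjI)
  qed (assumption | blast)+
  show "TC E p \<le> TC_g E p"
    unfolding TC_def TC_g_def secat_def secat_g_def
  proof (rule Inf_superset_mono, safe)
    let ?X = "fib_prod E p" and ?Y = "fib_path_space E p"
    fix n :: nat and V assume cov: "(\<Union>i\<le>n. V i) = topspace ?X"
      and s: "\<forall>i\<le>n. \<exists>s. section_over ?Y ?X endpoints (V i) s"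
    have "\<exists>W. openin ?X W \<and> V i \<subseteq> W \<and> (\<exists>s. section_over ?Y ?X endpoints W s)" if "i \<le> n" for i
    proof -
      obtain s where "section_over ?Y ?X endpoints (V i) s" using s \<open>i \<le> n\<close> by blast
      then have m: "fibre_motion E p (V i) (\<lambda>(v, t). s v t)" by (rule section_over_imp_fibre_motion)
      obtain W K where "openin ?X W" "V i \<subseteq> W" "fibre_motion E p W K"
        by (rule fibre_motion_extend_open[OF p E B m])
      then show ?thesis by (intro exI conjI) (assumption, assumption, rule fibre_motion_imp_section_over)
    qed
    then have "\<forall>i. \<exists>W. i \<le> n \<longrightarrow> openin ?X W \<and> V i \<subseteq> W \<and>
        (\<exists>s. section_over ?Y ?X endpoints W s)" by blast
    from choice[OF this] obtain W where W: "\<And>i. i \<le> n \<Longrightarrow> openin ?X (W i)"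
      "\<And>i. i \<le> n \<Longrightarrow> V i \<subseteq> W i"
      and sW: "\<And>i. i \<le> n \<Longrightarrow> \<exists>s. section_over ?Y ?X endpoints (W i) s" by blast
    have "(\<Union>i\<le>n. W i) = topspace ?X"
    proof
      show "(\<Union>i\<le>n. W i) \<subseteq> topspace ?X" using openin_subset[OF W(1)] by blast
      show "topspace ?X \<subseteq> (\<Union>i\<le>n. W i)" using W(2) unfolding cov[symmetric] by blast
    qed
    then show "\<exists>na. enat n = enat na \<and> (\<exists>V. (\<Union>i\<le>na. V i) = topspace ?X \<and>
       (\<forall>i\<le>na. openin ?X (V i) \<and> (\<exists>s. section_over ?Y ?X endpoints (V i) s)))"
      using W(1) sW by (intro exI[of _ n] exI[of _ W] conjI refl) simp_all
  qed
qed

section \<open>Motions of a bundle from equivariant motions of the fibre\<close>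

text \<open>Changing the trivialization moves both fibre coordinates of a pair by the same element
  of \<open>G\<close>. Invariance of \<open>U i\<close> makes membership independent of the
  trivialization, and equivariance of \<open>s i\<close> does the same for the motion. A wholly
  discontinuous choice of trivializations can therefore serve in the definitions.\<close>

lemma bundle_fibre_motions:
  fixes G :: "('g, 'z) monoid_scheme" and F :: "'f topology" and E :: "'e topology"
    and B :: "'b topology"
  assumes TG: "topspace T = carrier G" and act: "continuous_action G T F act"
    and lt: "locally_trivial_with_group G T F act E B p"
    and cov: "(\<Union>i\<le>k. U i) = topspace (prod_topology F F)"
    and inv: "\<And>i. i \<le> k \<Longrightarrow> invariant_set G (diag_act act act) (U i)"
    and sec: "\<And>i. i \<le> k \<Longrightarrow> section_over (path_space F) (prod_topology F F) endpoints (U i) (s i)"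
    and eqv: "\<And>i. i \<le> k \<Longrightarrow> equivariant_on G (diag_act act act) (path_act act) (U i) (s i)"
    and \<Delta>: "Id_on (topspace F) \<subseteq> U 0"
  obtains V h where "(\<Union>i\<le>k. V i) = topspace (fib_prod E p)"
    "\<And>i. i \<le> k \<Longrightarrow> fibre_motion E p (V i) (h i)" "Id_on (topspace E) \<subseteq> V (0::nat)"
proof -
  let ?X = "fib_prod E p"
  have pc: "continuous_map E B p" using lt unfolding locally_trivial_with_group_def by blast
  obtain C :: "('b set \<times> ('b \<times> 'f \<Rightarrow> 'e)) set" and \<theta> where
    triv: "\<forall>(O', \<phi>)\<in>C. local_trivialization F E B p O' \<phi>" and CB: "\<Union> (fst ` C) = topspace B"
    and tr: "\<forall>c\<in>C. \<forall>d\<in>C.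
          continuous_map (subtopology B (fst c \<inter> fst d)) T (\<theta> c d) \<and>
          (\<forall>b\<in>fst c \<inter> fst d. \<forall>x\<in>topspace F. snd d (b, x) = snd c (b, act (\<theta> c d b) x))"
    using lt unfolding locally_trivial_with_group_def by blast
  have lt: "openin B (fst c)"
    "homeomorphic_map (prod_topology (subtopology B (fst c)) F)
      (subtopology E {e \<in> topspace E. p e \<in> fst c}) (snd c)"
    "\<And>b x. b \<in> fst c \<Longrightarrow> x \<in> topspace F \<Longrightarrow> p (snd c (b, x)) = b" if "c \<in> C" for c
    using triv that unfolding local_trivialization_def by auto
  have "\<forall>c. \<exists>\<psi>. c \<in> C \<longrightarrow> homeomorphic_maps (prod_topology (subtopology B (fst c)) F)
      (subtopology E {e \<in> topspace E. p e \<in> fst c}) (snd c) \<psi>"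
    using lt(2) homeomorphic_map_maps by blast
  from choice[OF this] obtain \<psi> where \<psi>: "\<And>c. c \<in> C \<Longrightarrow>
      homeomorphic_maps (prod_topology (subtopology B (fst c)) F)
      (subtopology E {e \<in> topspace E. p e \<in> fst c}) (snd c) (\<psi> c)" by blast
  define \<xi> where "\<xi> c e = snd (\<psi> c e)" for c e
  have cB: "b \<in> topspace B" if "c \<in> C" "b \<in> fst c" for c b
    using that CB by blast
  have \<phi>c: "continuous_map (prod_topology (subtopology B (fst c)) F) E (snd c)"
    and \<psi>c: "continuous_map (subtopology E {e \<in> topspace E. p e \<in> fst c})
        (prod_topology (subtopology B (fst c)) F) (\<psi> c)" if "c \<in> C" for c
    using \<psi>[OF that] unfolding homeomorphic_maps_def by (auto simp: continuous_map_in_subtopology)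
  have \<xi>F: "\<xi> c e \<in> topspace F" and \<phi>\<xi>: "snd c (p e, \<xi> c e) = e"
    if c: "c \<in> C" and e: "e \<in> topspace E" and pe: "p e \<in> fst c" for c e
  proof -
    have eS: "e \<in> topspace (subtopology E {e \<in> topspace E. p e \<in> fst c})" using e pe by simp
    then have "\<psi> c e \<in> topspace (prod_topology (subtopology B (fst c)) F)"
      using continuous_map_image_subset_topspace[OF \<psi>c[OF c]] by blast
    then have m: "fst (\<psi> c e) \<in> fst c" "\<xi> c e \<in> topspace F" by (auto simp: \<xi>_def mem_Times_iff)
    have "snd c (\<psi> c e) = e" using \<psi>[OF c] eS unfolding homeomorphic_maps_def by blast
    then have eq: "snd c (fst (\<psi> c e), \<xi> c e) = e" by (simp add: \<xi>_def)
    then have "p e = fst (\<psi> c e)" using lt(3)[OF c m] by simp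
    then show "\<xi> c e \<in> topspace F" "snd c (p e, \<xi> c e) = e" using m eq by simp_all
  qed
  have \<xi>\<phi>: "\<xi> c (snd c (b, x)) = x" if "c \<in> C" "b \<in> fst c" "x \<in> topspace F" for c b x
  proof -
    have "\<psi> c (snd c (b, x)) = (b, x)"
      using \<psi>[OF that(1)] that cB[OF that(1,2)] unfolding homeomorphic_maps_def by simp
    then show ?thesis by (simp add: \<xi>_def)
  qed
  interpret A: group_action G "topspace F" act
    using act by (simp add: continuous_action_def)
  have \<theta>G: "\<theta> c d b \<in> carrier G"
    and tr': "\<And>x. x \<in> topspace F \<Longrightarrow> snd d (b, x) = snd c (b, act (\<theta> c d b) x)"
    if c: "c \<in> C" and d: "d \<in> C" and b: "b \<in> fst c" "b \<in> fst d" for c d b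
  proof -
    have "continuous_map (subtopology B (fst c \<inter> fst d)) T (\<theta> c d)"
      and *: "\<forall>b\<in>fst c \<inter> fst d. \<forall>x\<in>topspace F. snd d (b, x) = snd c (b, act (\<theta> c d b) x)"
      using tr c d by blast+
    then show "\<theta> c d b \<in> carrier G"
      using continuous_map_image_subset_topspace[of "subtopology B (fst c \<inter> fst d)" T "\<theta> c d"]
        cB[OF c b(1)] b TG by auto
    show "snd d (b, x) = snd c (b, act (\<theta> c d b) x)" if "x \<in> topspace F" for x
      using * b that by blast
  qed
  have \<xi>tr: "\<xi> c e = act (\<theta> c d (p e)) (\<xi> d e)"
    if c: "c \<in> C" and d: "d \<in> C" and e: "e \<in> topspace E" "p e \<in> fst c" "p e \<in> fst d" for c d e
  proof -
    have x: "\<xi> d e \<in> topspace F" by (rule \<xi>F[OF d e(1,3)])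
    have "act (\<theta> c d (p e)) (\<xi> d e) \<in> topspace F"
      by (rule A.element_image[OF \<theta>G[OF c d e(2,3)] x refl])
    from \<xi>\<phi>[OF c e(2) this] show ?thesis
      unfolding tr'[OF c d e(2,3) x, symmetric] \<phi>\<xi>[OF d e(1,3)] .
  qed
  define \<Xi> where "\<Xi> c v = (\<xi> c (fst v), \<xi> c (snd v))" for c v
  have \<Xi>tr: "\<Xi> c v = diag_act act act (\<theta> c d (p (fst v))) (\<Xi> d v)"
    if "c \<in> C" "d \<in> C" "v \<in> topspace ?X" "p (fst v) \<in> fst c" "p (fst v) \<in> fst d" for c d v
    using that \<xi>tr[of c d "fst v"] \<xi>tr[of c d "snd v"]
    by (auto simp: \<Xi>_def diag_act_def topspace_fib_prod)
  have "\<forall>b. \<exists>c. b \<in> topspace B \<longrightarrow> c \<in> C \<and> b \<in> fst c" using CB by blast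
  from choice[OF this] obtain ch where ch: "\<And>b. b \<in> topspace B \<Longrightarrow> ch b \<in> C \<and> b \<in> fst (ch b)" by blast
  have pB: "p e \<in> topspace B" if "e \<in> topspace E" for e
    using continuous_map_image_subset_topspace[OF pc] that by blast
  have vE: "fst v \<in> topspace E" "snd v \<in> topspace E" "p (snd v) = p (fst v)" if "v \<in> topspace ?X" for v
    using that by (auto simp: topspace_fib_prod)
  \<comment> \<open>No openness is to be expected here: the sets inherit the arbitrary shape of the
    \<open>U i\<close>.\<close>
  define V where "V i = {v \<in> topspace ?X. \<Xi> (ch (p (fst v))) v \<in> U i}" for i
  define h where "h i = (\<lambda>(v, t). snd (ch (p (fst v))) (p (fst v), s i (\<Xi> (ch (p (fst v))) v) t))" for i
  have chv: "ch (p (fst v)) \<in> C" "p (fst v) \<in> fst (ch (p (fst v)))" if "v \<in> topspace ?X" for v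
    using ch pB vE(1)[OF that] by auto
  have s: "continuous_map (subtopology (prod_topology F F) (U i)) (path_space F) (s i)"
    "\<And>u. u \<in> U i \<Longrightarrow> s i u 0 = fst u" "\<And>u. u \<in> U i \<Longrightarrow> s i u 1 = snd u"
    "\<And>u. u \<in> U i \<Longrightarrow> u \<in> topspace (prod_topology F F)" if "i \<le> k" for i
    using sec[OF that] by (auto simp: section_over_def endpoints_def prod_eq_iff)
  have se: "continuous_map (prod_topology (subtopology (prod_topology F F) (U i)) unit_interval) F
      (\<lambda>(u, t). s i u t)" if "i \<le> k" for i
    by (rule continuous_map_path_eval[OF s(1)[OF that]])
  have sF: "s i u t \<in> topspace F" if "i \<le> k" "u \<in> U i" "t \<in> {0..1}" for i u t
  proof -
    have "(u, t) \<in> topspace (prod_topology (subtopology (prod_topology F F) (U i)) unit_interval)"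
      using that s(4) by auto
    then have "(\<lambda>(u, t). s i u t) (u, t) \<in> topspace F"
      using continuous_map_image_subset_topspace[OF se[OF that(1)]] by blast
    then show ?thesis by simp
  qed
  have VU: "\<Xi> c v \<in> U i" if "i \<le> k" "v \<in> V i" "c \<in> C" "p (fst v) \<in> fst c" for i v c
  proof -
    have v: "v \<in> topspace ?X" "\<Xi> (ch (p (fst v))) v \<in> U i" using that(2) by (auto simp: V_def)
    show ?thesis
      using inv[OF that(1)] v(2) \<theta>G[OF that(3) chv(1)[OF v(1)] that(4) chv(2)[OF v(1)]]
      unfolding \<Xi>tr[OF that(3) chv(1)[OF v(1)] v(1) that(4) chv(2)[OF v(1)]] invariant_set_def
      by blast
  qed
  have hc: "h i (v, t) = snd c (p (fst v), s i (\<Xi> c v) t)"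
    if i: "i \<le> k" and v: "v \<in> V i" and c: "c \<in> C" "p (fst v) \<in> fst c" and t: "t \<in> {0..1}" for i v c t
  proof -
    define d where "d = ch (p (fst v))"
    have v': "v \<in> topspace ?X" "\<Xi> d v \<in> U i" using v by (auto simp: V_def d_def)
    have d: "d \<in> C" "p (fst v) \<in> fst d" using chv[OF v'(1)] by (simp_all add: d_def)
    have "s i (\<Xi> c v) = path_act act (\<theta> c d (p (fst v))) (s i (\<Xi> d v))"
      using eqv[OF i] \<theta>G[OF c(1) d(1) c(2) d(2)] v'(2)
      unfolding \<Xi>tr[OF c(1) d(1) v'(1) c(2) d(2)] equivariant_on_def by blast
    then have "s i (\<Xi> c v) t = act (\<theta> c d (p (fst v))) (s i (\<Xi> d v) t)"
      using t by (simp add: path_act_def)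
    then show ?thesis
      using tr'[OF c(1) d(1) c(2) d(2) sF[OF i v'(2) t]] by (simp add: h_def d_def)
  qed
  have "fibre_motion E p (V i) (h i)" if i: "i \<le> k" for i
    unfolding fibre_motion_def
  proof (intro conjI ballI)
    show VX: "V i \<subseteq> topspace ?X" by (auto simp: V_def)
    let ?P = "prod_topology (subtopology ?X (V i)) unit_interval"
    show "continuous_map ?P E (h i)"
    \<comment> \<open>Near \<open>z\<close> the single trivialization \<open>c\<close> describes
      \<open>h i\<close> at all points, by \<open>hc\<close>, and this description is a composite of
      continuous maps.\<close>
    proof (rule continuous_map_locally)
      fix z assume z: "z \<in> topspace ?P"
      define c where "c = ch (p (fst (fst z)))"
      have zV: "fst z \<in> V i" "snd z \<in> {0..1}" using z by (auto simp: mem_Times_iff)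
      have c: "c \<in> C" "p (fst (fst z)) \<in> fst c"
        using chv[of "fst z"] zV VX by (auto simp: c_def)
      let ?O = "{v \<in> topspace (subtopology ?X (V i)). p (fst v) \<in> fst c}"
      let ?R = "subtopology (subtopology ?X (V i)) ?O"
      have bR: "continuous_map (subtopology ?X (V i)) B (\<lambda>v. p (fst v))"
        by (intro continuous_map_from_subtopology continuous_map_compose_fun[OF pc continuous_map_fib_prod_fst])
      have oO: "openin (subtopology ?X (V i)) ?O"
        by (rule openin_continuous_map_preimage[OF bR lt(1)[OF c(1)]])
      have tR: "v \<in> V i" "v \<in> topspace ?X" "p (fst v) \<in> fst c" if "v \<in> topspace ?R" for v
        using that by auto
      have fsR: "continuous_map ?R (subtopology E {e \<in> topspace E. p e \<in> fst c}) fst"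
        "continuous_map ?R (subtopology E {e \<in> topspace E. p e \<in> fst c}) snd"
        using continuous_map_from_subtopology[OF continuous_map_from_subtopology[OF continuous_map_fib_prod_fst]]
          continuous_map_from_subtopology[OF continuous_map_from_subtopology[OF continuous_map_fib_prod_snd]]
          tR(3) vE[OF tR(2)]
        unfolding continuous_map_in_subtopology[where S = "{e \<in> topspace E. p e \<in> fst c}"]
        by (simp_all add: Pi_iff del: topspace_subtopology)
      have "continuous_map ?R (prod_topology F F) (\<Xi> c)"
        unfolding \<Xi>_def \<xi>_def
        by (intro continuous_map_pairedI fsR
            continuous_map_compose_fun[OF continuous_map_compose_fun[OF continuous_map_snd \<psi>c[OF c(1)]]])
      then have \<Xi>c: "continuous_map ?R (subtopology (prod_topology F F) (U i)) (\<Xi> c)"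
        unfolding continuous_map_in_subtopology[of ?R "prod_topology F F" "U i"]
        using VU[OF i _ c(1)] tR by blast
      have bc: "continuous_map ?R (subtopology B (fst c)) (\<lambda>v. p (fst v))"
        unfolding continuous_map_in_subtopology[of ?R B "fst c"]
        using continuous_map_from_subtopology[OF bR] tR(3) by blast
      let ?RI = "prod_topology ?R unit_interval"
      have "continuous_map ?RI E (\<lambda>z. snd c (p (fst (fst z)), (\<lambda>(u, t). s i u t) (\<Xi> c (fst z), snd z)))"
        by (intro continuous_map_compose_fun[OF \<phi>c[OF c(1)]] continuous_map_pairedI
            continuous_map_compose_fun[OF bc continuous_map_fst] continuous_map_compose_fun[OF se[OF i]]
            continuous_map_compose_fun[OF \<Xi>c continuous_map_fst] continuous_map_snd)
      then have "continuous_map ?RI E (h i)"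
      proof (rule continuous_map_eq)
        fix y assume "y \<in> topspace ?RI"
        then have y: "fst y \<in> topspace ?R" "snd y \<in> {0..1}" by (auto simp: mem_Times_iff)
        show "snd c (p (fst (fst y)), (\<lambda>(u, t). s i u t) (\<Xi> c (fst y), snd y)) = h i y"
          using hc[OF i tR(1)[OF y(1)] c(1) tR(3)[OF y(1)] y(2)] by simp
      qed
      moreover have "?RI = subtopology ?P (?O \<times> topspace unit_interval)"
        by (rule prod_topology_subtopology(1))
      moreover have "topspace unit_interval = {0..1}" by simp
      ultimately have "continuous_map (subtopology ?P (?O \<times> {0..1})) E (h i)" by (simp only:)
      moreover have "openin ?P (?O \<times> {0..1})" using oO by (simp add: openin_prod_Times_iff)
      moreover have "z \<in> ?O \<times> {0..1}"
      proof -
        have "fst z \<in> topspace (subtopology ?X (V i))"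
          using z by (simp only: topspace_prod_topology mem_Times_iff)
        then have "fst z \<in> ?O" using c(2) by blast
        then show ?thesis using zV(2) by (simp only: mem_Times_iff)
      qed
      ultimately show "\<exists>U. openin ?P U \<and> z \<in> U \<and> continuous_map (subtopology ?P U) E (h i)"
        by (intro exI conjI)
    qed
    fix v assume v: "v \<in> V i"
    have vX: "v \<in> topspace ?X" and vU: "\<Xi> (ch (p (fst v))) v \<in> U i" using v by (auto simp: V_def)
    note c = chv[OF vX]
    show "h i (v, 0) = fst v" "h i (v, 1) = snd v"
      using s(2,3)[OF i vU] \<phi>\<xi>[OF c(1) vE(1)[OF vX] c(2)] \<phi>\<xi>[OF c(1) vE(2)[OF vX]] c(2) vE(3)[OF vX]
      by (simp_all add: h_def \<Xi>_def)
    fix t :: real assume "t \<in> {0..1}"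
    then show "p (h i (v, t)) = p (fst v)"
      using lt(3)[OF c sF[OF i vU]] by (simp add: h_def)
  qed
  moreover have "(\<Union>i\<le>k. V i) = topspace ?X"
  proof
    show "topspace ?X \<subseteq> (\<Union>i\<le>k. V i)"
    proof
      fix v assume v: "v \<in> topspace ?X"
      have "\<Xi> (ch (p (fst v))) v \<in> topspace (prod_topology F F)"
        using \<xi>F[OF chv(1)[OF v] vE(1)[OF v]] \<xi>F[OF chv(1)[OF v] vE(2)[OF v]] chv(2)[OF v] vE(3)[OF v]
        by (simp add: \<Xi>_def)
      then show "v \<in> (\<Union>i\<le>k. V i)" using v unfolding cov[symmetric] by (auto simp: V_def)
    qed
  qed (auto simp: V_def)
  \<comment> \<open>Equal points have equal fibre coordinates in any one trivialization, so the
    diagonal of \<open>E\<close> is carried into that of \<open>F\<close>.\<close>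
  moreover have "Id_on (topspace E) \<subseteq> V 0"
  proof
    fix v assume "v \<in> Id_on (topspace E)"
    then obtain e where v: "v = (e, e)" and e: "e \<in> topspace E" by auto
    then have vX: "v \<in> topspace ?X" by (simp add: topspace_fib_prod)
    have "\<xi> (ch (p e)) e \<in> topspace F" using \<xi>F chv[OF vX] e by (simp add: v)
    then have "\<Xi> (ch (p (fst v))) v \<in> U 0" using \<Delta> by (auto simp: \<Xi>_def v)
    then show "v \<in> V 0" using vX by (simp add: V_def)
  qed
  ultimately show thesis using that by blast
qed

theorem corollary3p17:
  fixes G :: "('g, 'z) monoid_scheme" and T :: "'g topology" and n :: nat and A :: "'g chart set"
    and F :: "'f topology" and actF :: "'g \<Rightarrow> 'f \<Rightarrow> 'f"
    and P :: "'q topology" and actP :: "'g \<Rightarrow> 'q \<Rightarrow> 'q" and \<tau> :: "'q \<Rightarrow> 'b"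
    and E :: "'e topology" and B :: "'b topology" and p :: "'e \<Rightarrow> 'b"
    and k :: nat and U :: "nat \<Rightarrow> ('f \<times> 'f) set" and s :: "nat \<Rightarrow> 'f \<times> 'f \<Rightarrow> real \<Rightarrow> 'f"
  assumes "lie_group G T n A" and "compact_space T"
    and "Hausdorff_space F" and "continuous_action G T F actF" and "path_connected_space F"
    and "hurewicz_fibration E B p" and "locally_trivial_with_group G T F actF E B p"
    and "metrizable_ANR E" and "separable_space E"
    and "metrizable_ANR B" and "separable_space B"
    and "Hausdorff_space P" and "principal_bundle G T P actP B \<tau>"
    and "is_associated_bundle G F actF P actP \<tau> E p"
    and "(\<Union>i\<le>k. U i) = topspace (prod_topology F F)"
    and "\<And>i. i \<le> k \<Longrightarrow> invariant_set G (diag_act actF actF) (U i)"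
    and "\<And>i. i \<le> k \<Longrightarrow> section_over (path_space F) (prod_topology F F) endpoints (U i) (s i)"
    and "\<And>i. i \<le> k \<Longrightarrow> equivariant_on G (diag_act actF actF) (path_act actF) (U i) (s i)"
    and "Id_on (topspace F) \<subseteq> U 0"
  shows "TC_M E p \<le> enat k \<and>
    (TC E p = enat k \<longrightarrow> TC_M E p = TC E p \<and> TC E p = TC_g E p \<and> TC_g E p = enat k)"
proof -
  note fib = assms(6) and E = assms(8,9) and B = assms(10)
  have T: "topspace T = carrier G" using assms(1) by (simp add: lie_group_def)
  obtain V h where cov: "(\<Union>i\<le>k. V i) = topspace (fib_prod E p)"
    and h: "\<And>i. i \<le> k \<Longrightarrow> fibre_motion E p (V i) (h i)" and \<Delta>: "Id_on (topspace E) \<subseteq> V 0"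
    by (rule bundle_fibre_motions[OF T assms(4,7,15) assms(16,17,18,19)]) (auto intro: that)
  have "\<forall>i. \<exists>W K. i \<le> k \<longrightarrow> openin (fib_prod E p) W \<and> V i \<subseteq> W \<and> fibre_motion E p W K"
  proof
    fix i
    show "\<exists>W K. i \<le> k \<longrightarrow> openin (fib_prod E p) W \<and> V i \<subseteq> W \<and> fibre_motion E p W K"
    proof (cases "i \<le> k")
      case True
      obtain W K where "openin (fib_prod E p) W" "V i \<subseteq> W" "fibre_motion E p W K"
        by (rule fibre_motion_extend_open[OF fib E B h[OF True]])
      then show ?thesis by blast
    qed simp
  qed
  then obtain W K where W: "\<And>i. i \<le> k \<Longrightarrow> openin (fib_prod E p) (W i)"
      "\<And>i. i \<le> k \<Longrightarrow> V i \<subseteq> W i" "\<And>i. i \<le> k \<Longrightarrow> fibre_motion E p (W i) (K i)"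
    by metis
  have "(\<Union>i\<le>k. W i) = topspace (fib_prod E p)"
  proof
    show "(\<Union>i\<le>k. W i) \<subseteq> topspace (fib_prod E p)" using openin_subset[OF W(1)] by blast
    show "topspace (fib_prod E p) \<subseteq> (\<Union>i\<le>k. W i)" using W(2) unfolding cov[symmetric] by blast
  qed
  moreover have "Id_on (topspace E) \<subseteq> W 0" using \<Delta> W(2)[OF le0] by blast
  ultimately have "TC_M E p \<le> enat k" using W by (intro TC_M_le[OF fib E(1) B]) auto
  \<comment> \<open>If \<open>TC E p\<close> equals \<open>k\<close>, it is squeezed together with
    \<open>TC_M E p\<close> between \<open>k\<close> and \<open>k\<close>; the agreement with
    \<open>TC_g E p\<close> holds for any value.\<close>
  then show ?thesis using TC_le_TC_M[of E p] TC_eq_TC_g[OF fib E B] by auto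
qed

end
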